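(* Let $\mathbb G$ be a category, let $G:(\mathscr A,\mathtt{A})\to(\mathscr X,\mathtt{A})$ be a surfunctor over $\mathbb G$ with left suradjoint $F$, let $T$ be the induced surmonad on $(\mathscr X,\mathtt{A})$, let $F^T\dashv G^T$, $G^T:(\mathscr X^T,\mathtt{A})\to(\mathscr X,\mathtt{A})$, be the canonical Eilenberg–Moore suradjunction, and let $K:(\mathscr A,\mathtt{A})\to(\mathscr X^T,\mathtt{A})$ be the comparison surfunctor, i.e. the unique surfunctor with $G^TK=G$ and $KF=F^T$. Then the following conditions are equivalent: 1. $K$ is an isomorphism in $\mathrm{Cat}/\mathbb G$ (i.e. there is a surfunctor $L:(\mathscr X^T,\mathtt{A})\to(\mathscr A,\mathtt{A})$ with $KL=1_{\mathscr X^T}$ and $LK=1_{\mathscr A}$). 2. $G$ creates surcoequalizers of those pairs $f,g:a\rightrightarrows b$ for which the pair $G(f),G(g):G(a)\rightrightarrows G(b)$ has an absolute surcoequalizer. 3. $G$ creates surcoequalizers of those pairs $f,g:a\rightrightarrows b$ for which the pair $G(f),G(g):G(a)\rightrightarrows G(b)$ has a split surcoequalizer.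
   Context: A surcategory over $\mathbb G$ is a pair $(\mathscr E,\mathtt{A})$ with $\mathtt{A}:\mathscr E\to\mathbb G$ a functor (the arity functor; same letter for all surcategories), i.e. an object of the 2-category $\mathrm{Cat}/\mathbb G$. A surfunctor is a functor commuting with the arity functors. A suradjunction (resp. surmonad) is an adjunction (resp. monad) in $\mathrm{Cat}/\mathbb G$; in particular units, counits and multiplications have components sent to identities by the arity functors. The Eilenberg–Moore category $\mathscr X^T$ of a surmonad $T$ is a surcategory with arity $(x,h)\mapsto\mathtt{A}(x)$. For $B\in\mathbb G$ the fiber $\mathscr E_B$ consists of the objects over $B$ and the arrows over $1_B$. A surcoequalizer of a parallel pair $f,g:a\rightrightarrows b$ lying in a fiber $\mathscr E_B$ is an arrow $q:b\to c$ in $\mathscr E_B$ with $qf=qg$ such that for every arrow $q':b\to y$ of $\mathscr E$ (over any arrow $B\to\mathtt{A}(y)$ of $\mathbb G$) with $q'f=q'g$ there is a unique $k:c\to y$ in $\mathscr E$ with $\mathtt{A}(k)=\mathtt{A}(q')$ and $kq=q'$. A surcoequalizer is absolute if it is preserved by every surfunctor out of $(\mathscr E,\mathtt{A})$. It is split if it is part of a split fork in a fiber: $q f=q g$ and there are arrows $s:c\to b$, $t:b\to a$ in the same fiber with $qs=1_c$, $ft=1_b$, $gt=sq$. $G$ creates the surcoequalizers of pairs in a given class if, for every pair $f,g:a\rightrightarrows b$ in a fiber of $\mathscr A$ in this class and every surcoequalizer $e:G(b)\to z$ of $G(f),G(g)$ of the indicated type (absolute, resp. split), there are a unique object $c$ and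 a unique arrow $q:b\to c$ of $\mathscr A$ with $G(c)=z$ and $G(q)=e$, and moreover $q$ is a surcoequalizer of $f,g$. *)

theory Defs
  imports Main
begin

section \<open>Categories and functors\<close>

record ('o, 'a) cat =
  Obj :: "'o set"
  Arr :: "'a set"
  Dom :: "'a \<Rightarrow> 'o"
  Cod :: "'a \<Rightarrow> 'o"
  Ident :: "'o \<Rightarrow> 'a"
  Comp :: "'a \<Rightarrow> 'a \<Rightarrow> 'a"  (infixl "\<cdot>\<index>" 70)

definition hom :: "('o, 'a, 'z) cat_scheme \<Rightarrow> 'o \<Rightarrow> 'o \<Rightarrow> 'a set" where
  "hom C x y = {f \<in> Arr C. Dom C f = x \<and> Cod C f = y}"

locale category =
  fixes C :: "('o, 'a, 'z) cat_scheme" (structure)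
  assumes dom_closed: "f \<in> Arr C \<Longrightarrow> Dom C f \<in> Obj C"
    and cod_closed: "f \<in> Arr C \<Longrightarrow> Cod C f \<in> Obj C"
    and ident_closed: "x \<in> Obj C \<Longrightarrow> Ident C x \<in> hom C x x"
    and comp_closed: "f \<in> hom C x y \<Longrightarrow> g \<in> hom C y z \<Longrightarrow> g \<cdot> f \<in> hom C x z"
    and ident_left: "f \<in> hom C x y \<Longrightarrow> Ident C y \<cdot> f = f"
    and ident_right: "f \<in> hom C x y \<Longrightarrow> f \<cdot> Ident C x = f"
    and comp_assoc: "f \<in> hom C w x \<Longrightarrow> g \<in> hom C x y \<Longrightarrow> h \<in> hom C y z \<Longrightarrow>
      (h \<cdot> g) \<cdot> f = h \<cdot> (g \<cdot> f)"

record ('o, 'a, 'p, 'c) func =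
  omap :: "'o \<Rightarrow> 'p"
  amap :: "'a \<Rightarrow> 'c"

definition is_functor ::
  "('o, 'a, 'z) cat_scheme \<Rightarrow> ('p, 'c, 'y) cat_scheme \<Rightarrow> ('o, 'a, 'p, 'c) func \<Rightarrow> bool" where
  "is_functor C D F \<longleftrightarrow>
     (\<forall>x \<in> Obj C. omap F x \<in> Obj D) \<and>
     (\<forall>f \<in> Arr C. amap F f \<in> hom D (omap F (Dom C f)) (omap F (Cod C f))) \<and>
     (\<forall>x \<in> Obj C. amap F (Ident C x) = Ident D (omap F x)) \<and>
     (\<forall>f \<in> Arr C. \<forall>g \<in> Arr C. Cod C f = Dom C g \<longrightarrow>
        amap F (g \<cdot>\<^bsub>C\<^esub> f) = amap F g \<cdot>\<^bsub>D\<^esub> amap F f)"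

definition fid :: "('o, 'a, 'o, 'a) func" where
  "fid = \<lparr>omap = \<lambda>x. x, amap = \<lambda>f. f\<rparr>"

definition fcomp ::
  "('p, 'c, 'q, 'd) func \<Rightarrow> ('o, 'a, 'p, 'c) func \<Rightarrow> ('o, 'a, 'q, 'd) func"  (infixl "\<circ>\<^sub>F" 70) where
  "G \<circ>\<^sub>F F = \<lparr>omap = \<lambda>x. omap G (omap F x), amap = \<lambda>f. amap G (amap F f)\<rparr>"

text \<open>Only the values of a functor on the objects and arrows of its domain are meaningful, so
  equality of functors out of \<open>C\<close> is equality there.\<close>

definition functor_eq ::
  "('o, 'a, 'z) cat_scheme \<Rightarrow> ('o, 'a, 'p, 'c) func \<Rightarrow> ('o, 'a, 'p, 'c) func \<Rightarrow> bool" where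
  "functor_eq C F G \<longleftrightarrow>
     (\<forall>x \<in> Obj C. omap F x = omap G x) \<and> (\<forall>f \<in> Arr C. amap F f = amap G f)"


section \<open>Surcategories\<close>

record ('o, 'a, 'b, 'h) surcat = "('o, 'a) cat" +
  arity :: "('o, 'a, 'b, 'h) func"

definition surcategory :: "('b, 'h) cat \<Rightarrow> ('o, 'a, 'b, 'h) surcat \<Rightarrow> bool" where
  "surcategory S E \<longleftrightarrow> category S \<and> category E \<and> is_functor E S (arity E)"

definition surfunctor ::
  "('b, 'h) cat \<Rightarrow> ('o, 'a, 'b, 'h) surcat \<Rightarrow> ('p, 'c, 'b, 'h) surcat \<Rightarrow>
   ('o, 'a, 'p, 'c) func \<Rightarrow> bool" where
  "surfunctor S E D H \<longleftrightarrow> is_functor E D H \<and> functor_eq E (arity D \<circ>\<^sub>F H) (arity E)"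

definition fiber :: "('b, 'h) cat \<Rightarrow> ('o, 'a, 'b, 'h) surcat \<Rightarrow> 'b \<Rightarrow> ('o, 'a) cat" where
  "fiber S E B =
     \<lparr>Obj = {x \<in> Obj E. omap (arity E) x = B},
      Arr = {f \<in> Arr E. amap (arity E) f = Ident S B},
      Dom = Dom E, Cod = Cod E, Ident = Ident E, Comp = Comp E\<rparr>"

text \<open>A natural transformation between surfunctors \<open>F, G\<close>, with components over identities.\<close>

definition surnat ::
  "('b, 'h) cat \<Rightarrow> ('o, 'a, 'b, 'h) surcat \<Rightarrow> ('p, 'c, 'b, 'h) surcat \<Rightarrow>
   ('o, 'a, 'p, 'c) func \<Rightarrow> ('o, 'a, 'p, 'c) func \<Rightarrow> ('o \<Rightarrow> 'c) \<Rightarrow> bool" where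
  "surnat S E D F G \<tau> \<longleftrightarrow>
     (\<forall>x \<in> Obj E. \<tau> x \<in> hom D (omap F x) (omap G x) \<and>
        amap (arity D) (\<tau> x) = Ident S (omap (arity E) x)) \<and>
     (\<forall>f \<in> Arr E. \<tau> (Cod E f) \<cdot>\<^bsub>D\<^esub> amap F f = amap G f \<cdot>\<^bsub>D\<^esub> \<tau> (Dom E f))"

text \<open>\<open>F : X \<rightarrow> A\<close> is left suradjoint to \<open>G : A \<rightarrow> X\<close>, with unit \<open>\<eta>\<close> and counit \<open>\<epsilon>\<close>.\<close>

definition suradjunction ::
  "('b, 'h) cat \<Rightarrow> ('o, 'a, 'b, 'h) surcat \<Rightarrow> ('p, 'c, 'b, 'h) surcat \<Rightarrow>
   ('p, 'c, 'o, 'a) func \<Rightarrow> ('o, 'a, 'p, 'c) func \<Rightarrow> ('p \<Rightarrow> 'c) \<Rightarrow> ('o \<Rightarrow> 'a) \<Rightarrow> bool" where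
  "suradjunction S A X F G \<eta> \<epsilon> \<longleftrightarrow>
     surfunctor S X A F \<and> surfunctor S A X G \<and>
     surnat S X X fid (G \<circ>\<^sub>F F) \<eta> \<and> surnat S A A (F \<circ>\<^sub>F G) fid \<epsilon> \<and>
     (\<forall>x \<in> Obj X. \<epsilon> (omap F x) \<cdot>\<^bsub>A\<^esub> amap F (\<eta> x) = Ident A (omap F x)) \<and>
     (\<forall>a \<in> Obj A. amap G (\<epsilon> a) \<cdot>\<^bsub>X\<^esub> \<eta> (omap G a) = Ident X (omap G a))"


section \<open>Surmonads and Eilenberg--Moore surcategories\<close>

record ('o, 'a) monad =
  endo :: "('o, 'a, 'o, 'a) func"
  unit :: "'o \<Rightarrow> 'a"
  mult :: "'o \<Rightarrow> 'a"

definition surmonad ::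
  "('b, 'h) cat \<Rightarrow> ('o, 'a, 'b, 'h) surcat \<Rightarrow> ('o, 'a) monad \<Rightarrow> bool" where
  "surmonad S X T \<longleftrightarrow>
     surfunctor S X X (endo T) \<and>
     surnat S X X fid (endo T) (unit T) \<and>
     surnat S X X (endo T \<circ>\<^sub>F endo T) (endo T) (mult T) \<and>
     (\<forall>x \<in> Obj X.
        mult T x \<cdot>\<^bsub>X\<^esub> unit T (omap (endo T) x) = Ident X (omap (endo T) x) \<and>
        mult T x \<cdot>\<^bsub>X\<^esub> amap (endo T) (unit T x) = Ident X (omap (endo T) x) \<and>
        mult T x \<cdot>\<^bsub>X\<^esub> mult T (omap (endo T) x) = mult T x \<cdot>\<^bsub>X\<^esub> amap (endo T) (mult T x))"

definition induced_monad ::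
  "('p, 'c, 'o, 'a) func \<Rightarrow> ('o, 'a, 'p, 'c) func \<Rightarrow> ('p \<Rightarrow> 'c) \<Rightarrow> ('o \<Rightarrow> 'a) \<Rightarrow> ('p, 'c) monad" where
  "induced_monad F G \<eta> \<epsilon> =
     \<lparr>endo = G \<circ>\<^sub>F F, unit = \<eta>, mult = \<lambda>x. amap G (\<epsilon> (omap F x))\<rparr>"

definition algebras :: "('o, 'a, 'z) cat_scheme \<Rightarrow> ('o, 'a) monad \<Rightarrow> ('o \<times> 'a) set" where
  "algebras X T =
     {(x, h). x \<in> Obj X \<and> h \<in> hom X (omap (endo T) x) x \<and>
        h \<cdot>\<^bsub>X\<^esub> unit T x = Ident X x \<and>
        h \<cdot>\<^bsub>X\<^esub> amap (endo T) h = h \<cdot>\<^bsub>X\<^esub> mult T x}"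

text \<open>An arrow of the Eilenberg--Moore category is a triple consisting of its domain, the
  underlying arrow and its codomain.  The structure arrow \<open>h\<close> of an algebra is not required to lie
  over an identity: this follows from \<open>h \<cdot> unit T x = Ident X x\<close>.\<close>

definition EM ::
  "('o, 'a, 'b, 'h) surcat \<Rightarrow> ('o, 'a) monad \<Rightarrow>
   ('o \<times> 'a, ('o \<times> 'a) \<times> 'a \<times> ('o \<times> 'a), 'b, 'h) surcat" where
  "EM X T =
     \<lparr>Obj = algebras X T,
      Arr = {((x, h), f, (y, k)). (x, h) \<in> algebras X T \<and> (y, k) \<in> algebras X T \<and>
               f \<in> hom X x y \<and> f \<cdot>\<^bsub>X\<^esub> h = k \<cdot>\<^bsub>X\<^esub> amap (endo T) f},
      Dom = \<lambda>(p, f, r). p,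
      Cod = \<lambda>(p, f, r). r,
      Ident = \<lambda>p. (p, Ident X (fst p), p),
      Comp = \<lambda>(p', g, r) (p, f, r'). (p, g \<cdot>\<^bsub>X\<^esub> f, r),
      arity = \<lparr>omap = \<lambda>(x, h). omap (arity X) x, amap = \<lambda>(p, f, r). amap (arity X) f\<rparr>\<rparr>"

definition forget_EM :: "('o \<times> 'a, ('o \<times> 'a) \<times> 'a \<times> ('o \<times> 'a), 'o, 'a) func" where
  "forget_EM = \<lparr>omap = \<lambda>(x, h). x, amap = \<lambda>(p, f, r). f\<rparr>"

definition free_EM ::
  "('o, 'a, 'z) cat_scheme \<Rightarrow> ('o, 'a) monad \<Rightarrow>
   ('o, 'a, 'o \<times> 'a, ('o \<times> 'a) \<times> 'a \<times> ('o \<times> 'a)) func" where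
  "free_EM X T =
     \<lparr>omap = \<lambda>x. (omap (endo T) x, mult T x),
      amap = \<lambda>f. ((omap (endo T) (Dom X f), mult T (Dom X f)), amap (endo T) f,
                   (omap (endo T) (Cod X f), mult T (Cod X f)))\<rparr>"

definition comparison ::
  "('b, 'h) cat \<Rightarrow> ('o, 'a, 'b, 'h) surcat \<Rightarrow> ('p, 'c, 'b, 'h) surcat \<Rightarrow>
   ('p, 'c, 'o, 'a) func \<Rightarrow> ('o, 'a, 'p, 'c) func \<Rightarrow> ('p, 'c) monad \<Rightarrow>
   ('o, 'a, 'p \<times> 'c, ('p \<times> 'c) \<times> 'c \<times> ('p \<times> 'c)) func \<Rightarrow> bool" where
  "comparison S A X F G T K \<longleftrightarrow>
     surfunctor S A (EM X T) K \<and>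
     functor_eq A (forget_EM \<circ>\<^sub>F K) G \<and>
     functor_eq X (K \<circ>\<^sub>F F) (free_EM X T)"

definition sur_isomorphism ::
  "('b, 'h) cat \<Rightarrow> ('o, 'a, 'b, 'h) surcat \<Rightarrow> ('p, 'c, 'b, 'h) surcat \<Rightarrow>
   ('o, 'a, 'p, 'c) func \<Rightarrow> bool" where
  "sur_isomorphism S E D K \<longleftrightarrow>
     surfunctor S E D K \<and>
     (\<exists>L. surfunctor S D E L \<and> functor_eq D (K \<circ>\<^sub>F L) fid \<and> functor_eq E (L \<circ>\<^sub>F K) fid)"


section \<open>Surcoequalizers\<close>

definition parallel_pair ::
  "('b, 'h) cat \<Rightarrow> ('o, 'a, 'b, 'h) surcat \<Rightarrow> 'b \<Rightarrow> 'o \<Rightarrow> 'o \<Rightarrow> 'a \<Rightarrow> 'a \<Rightarrow> bool" where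
  "parallel_pair S E B a b f g \<longleftrightarrow>
     B \<in> Obj S \<and> f \<in> hom (fiber S E B) a b \<and> g \<in> hom (fiber S E B) a b"

text \<open>\<open>q : b \<rightarrow> c\<close> is a surcoequalizer of the pair \<open>f, g : a \<rightarrow> b\<close> in the fiber over \<open>B\<close>.\<close>

definition surcoequalizer ::
  "('b, 'h) cat \<Rightarrow> ('o, 'a, 'b, 'h) surcat \<Rightarrow> 'b \<Rightarrow> 'o \<Rightarrow> 'o \<Rightarrow> 'a \<Rightarrow> 'a \<Rightarrow> 'o \<Rightarrow> 'a \<Rightarrow> bool" where
  "surcoequalizer S E B a b f g c q \<longleftrightarrow>
     parallel_pair S E B a b f g \<and>
     q \<in> hom (fiber S E B) b c \<and> q \<cdot>\<^bsub>E\<^esub> f = q \<cdot>\<^bsub>E\<^esub> g \<and>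
     (\<forall>y. \<forall>q' \<in> hom E b y. q' \<cdot>\<^bsub>E\<^esub> f = q' \<cdot>\<^bsub>E\<^esub> g \<longrightarrow>
        (\<exists>!k. k \<in> hom E c y \<and> amap (arity E) k = amap (arity E) q' \<and> k \<cdot>\<^bsub>E\<^esub> q = q'))"

text \<open>HOL cannot quantify over the types of objects and arrows of the target surcategory, so the
  targets here live on two fixed types built from those of \<open>E\<close>.  These are large enough for nothing
  to be lost: preservation by surfunctors into surcategories on arbitrary types follows, by
  \<open>absolute_preserved\<close> below.\<close>

definition absolute_surcoequalizer ::
  "('b, 'h) cat \<Rightarrow> ('o, 'a, 'b, 'h) surcat \<Rightarrow> 'b \<Rightarrow> 'o \<Rightarrow> 'o \<Rightarrow> 'a \<Rightarrow> 'a \<Rightarrow> 'o \<Rightarrow> 'a \<Rightarrow> bool" where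
  "absolute_surcoequalizer S E B a b f g c q \<longleftrightarrow>
     surcoequalizer S E B a b f g c q \<and>
     (\<forall>(D :: ('o option, ('a + nat) list, 'b, 'h) surcat) H.
        surcategory S D \<and> surfunctor S E D H \<longrightarrow>
        surcoequalizer S D B (omap H a) (omap H b) (amap H f) (amap H g) (omap H c) (amap H q))"

definition split_surcoequalizer ::
  "('b, 'h) cat \<Rightarrow> ('o, 'a, 'b, 'h) surcat \<Rightarrow> 'b \<Rightarrow> 'o \<Rightarrow> 'o \<Rightarrow> 'a \<Rightarrow> 'a \<Rightarrow> 'o \<Rightarrow> 'a \<Rightarrow> bool" where
  "split_surcoequalizer S E B a b f g c q \<longleftrightarrow>
     surcoequalizer S E B a b f g c q \<and>
     (\<exists>s \<in> hom (fiber S E B) c b. \<exists>t \<in> hom (fiber S E B) b a.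
        q \<cdot>\<^bsub>E\<^esub> s = Ident E c \<and> f \<cdot>\<^bsub>E\<^esub> t = Ident E b \<and> g \<cdot>\<^bsub>E\<^esub> t = s \<cdot>\<^bsub>E\<^esub> q)"

text \<open>Here \<open>type_of B a b f g z e\<close> says that \<open>e : b \<rightarrow> z\<close> is a surcoequalizer in \<open>X\<close> of \<open>f, g : a \<rightarrow> b\<close>
  of the type considered.  A pair in \<open>A\<close> belongs to the corresponding class iff its image under \<open>G\<close>
  has some such \<open>e\<close>, so membership in the class is implied by the premise on \<open>e\<close>.\<close>

definition creates_surcoequalizers ::
  "('b, 'h) cat \<Rightarrow> ('o, 'a, 'b, 'h) surcat \<Rightarrow> ('o, 'a, 'p, 'c) func \<Rightarrow>
   ('b \<Rightarrow> 'p \<Rightarrow> 'p \<Rightarrow> 'c \<Rightarrow> 'c \<Rightarrow> 'p \<Rightarrow> 'c \<Rightarrow> bool) \<Rightarrow> bool" where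
  "creates_surcoequalizers S A G type_of \<longleftrightarrow>
     (\<forall>B a b f g z e.
        parallel_pair S A B a b f g \<and>
        type_of B (omap G a) (omap G b) (amap G f) (amap G g) z e \<longrightarrow>
        (\<exists>c q. q \<in> hom A b c \<and> omap G c = z \<and> amap G q = e \<and>
           (\<forall>c' q'. q' \<in> hom A b c' \<and> omap G c' = z \<and> amap G q' = e \<longrightarrow> c' = c \<and> q' = q) \<and>
           surcoequalizer S A B a b f g c q))"


section \<open>Absolute surcoequalizers are preserved by all surfunctors\<close>

text \<open>The point is that only the subcategory of the target generated by the image of the surfunctor
  and finitely many further arrows matters, and that its arrows are represented by words.\<close>

inductive_set generated :: "('o, 'a, 'z) cat_scheme \<Rightarrow> 'a set \<Rightarrow> 'a set"
  for D :: "('o, 'a, 'z) cat_scheme" and Y :: "'a set" where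
  base: "u \<in> Y \<Longrightarrow> u \<in> generated D Y"
| step: "u \<in> generated D Y \<Longrightarrow> v \<in> Y \<Longrightarrow> Cod D u = Dom D v \<Longrightarrow> v \<cdot>\<^bsub>D\<^esub> u \<in> generated D Y"

fun word_value :: "('o, 'a, 'z) cat_scheme \<Rightarrow> ('w \<Rightarrow> 'a) \<Rightarrow> 'w list \<Rightarrow> 'a" where
  "word_value D l [] = undefined"
| "word_value D l [w] = l w"
| "word_value D l (w # ws) = l w \<cdot>\<^bsub>D\<^esub> word_value D l ws"

lemma generated_words: "generated D (range l) \<subseteq> range (word_value D l)"
proof
  fix u assume "u \<in> generated D (range l)"
  then have "\<exists>ws. ws \<noteq> [] \<and> u = word_value D l ws"
  proof induction
    case (base u)
    then obtain w where "u = l w" by auto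
    then show ?case by (intro exI[of _ "[w]"]) simp
  next
    case (step u v)
    then obtain w ws where "v = l w" "ws \<noteq> []" "u = word_value D l ws" by auto
    then show ?case by (intro exI[of _ "w # ws"]) (cases ws; simp)
  qed
  then show "u \<in> range (word_value D l)" by auto
qed

lemma (in category) comp_arr:
  assumes "u \<in> Arr C" "v \<in> Arr C" "Cod C u = Dom C v"
  shows "v \<cdot> u \<in> Arr C" "Dom C (v \<cdot> u) = Dom C u" "Cod C (v \<cdot> u) = Cod C v"
  using comp_closed[of u "Dom C u" "Dom C v" v "Cod C v"] assms by (auto simp: hom_def)

lemma (in category) generated_arr:
  assumes "Y \<subseteq> Arr C" "u \<in> generated C Y"
  shows "u \<in> Arr C"
  using assms(2)
proof induction
  case (base u)
  then show ?case using assms(1) by blast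
next
  case (step u v)
  then show ?case using assms(1) comp_arr(1) by blast
qed

lemma (in category) generated_comp:
  assumes "Y \<subseteq> Arr C" "v \<in> generated C Y" "u \<in> generated C Y" "Cod C u = Dom C v"
  shows "v \<cdot> u \<in> generated C Y"
  using assms(2,4)
proof induction
  case (base v)
  then show ?case by (rule generated.step[OF assms(3)])
next
  case (step v w)
  have arr: "u \<in> Arr C" "v \<in> Arr C" "w \<in> Arr C"
    using step(1,2) generated_arr[OF assms(1)] assms(1,3) by blast+
  have cod: "Cod C u = Dom C v"
    using step(5) comp_arr(2)[OF arr(2,3) step(3)] by simp
  have "(w \<cdot> v) \<cdot> u = w \<cdot> (v \<cdot> u)"
    by (rule comp_assoc[of _ "Dom C u" "Dom C v" _ "Dom C w" _ "Cod C w"])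
      (use arr cod step(3) in \<open>simp_all add: hom_def\<close>)
  moreover have "w \<cdot> (v \<cdot> u) \<in> generated C Y"
    using step(4)[OF cod] step(2)
    by (rule generated.step) (simp add: comp_arr(3)[OF arr(1,2) cod] step(3))
  ultimately show ?case by simp
qed

text \<open>The subcategory of \<open>D\<close> on \<open>P\<close> and \<open>Q\<close>, transported along \<open>i, j\<close> with inverses \<open>i', j'\<close>.\<close>

definition transport ::
  "('p, 'c, 'b, 'h) surcat \<Rightarrow> 'p set \<Rightarrow> 'c set \<Rightarrow> ('p \<Rightarrow> 'o) \<Rightarrow> ('o \<Rightarrow> 'p) \<Rightarrow> ('c \<Rightarrow> 'a) \<Rightarrow> ('a \<Rightarrow> 'c) \<Rightarrow>
   ('o, 'a, 'b, 'h) surcat" where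
  "transport D P Q i i' j j' =
     \<lparr>Obj = i ` P, Arr = j ` Q, Dom = i \<circ> Dom D \<circ> j', Cod = i \<circ> Cod D \<circ> j',
      Ident = j \<circ> Ident D \<circ> i', Comp = \<lambda>v u. j (j' v \<cdot>\<^bsub>D\<^esub> j' u),
      arity = \<lparr>omap = omap (arity D) \<circ> i', amap = amap (arity D) \<circ> j'\<rparr>\<rparr>"

locale transported_subcategory =
  fixes S :: "('b, 'h) cat" and D :: "('p, 'c, 'b, 'h) surcat"
    and P Q and i :: "'p \<Rightarrow> 'o" and i' and j :: "'c \<Rightarrow> 'a" and j'
  assumes D: "surcategory S D"
    and P: "P \<subseteq> Obj D" and Q: "Q \<subseteq> Arr D"
    and dom_P: "\<And>u. u \<in> Q \<Longrightarrow> Dom D u \<in> P" and cod_P: "\<And>u. u \<in> Q \<Longrightarrow> Cod D u \<in> P"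
    and ident_Q: "\<And>x. x \<in> P \<Longrightarrow> Ident D x \<in> Q"
    and comp_Q: "\<And>u v. u \<in> Q \<Longrightarrow> v \<in> Q \<Longrightarrow> Cod D u = Dom D v \<Longrightarrow> v \<cdot>\<^bsub>D\<^esub> u \<in> Q"
    and i: "\<And>x. x \<in> P \<Longrightarrow> i' (i x) = x" and j: "\<And>u. u \<in> Q \<Longrightarrow> j' (j u) = u"
begin

abbreviation "D' \<equiv> transport D P Q i i' j j'"

lemma cat_D: "category D"
  using D by (simp add: surcategory_def)

lemma i_eq: "x \<in> P \<Longrightarrow> y \<in> P \<Longrightarrow> i x = i y \<longleftrightarrow> x = y"
  using i by metis

lemma j_eq: "u \<in> Q \<Longrightarrow> v \<in> Q \<Longrightarrow> j u = j v \<longleftrightarrow> u = v"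
  using j by metis

lemma hom_D': "u' \<in> hom D' x' y' \<longleftrightarrow>
    (\<exists>u \<in> Q. u' = j u \<and> x' = i (Dom D u) \<and> y' = i (Cod D u))"
  by (auto simp: hom_def transport_def j)

lemma hom_D'_j: "u \<in> Q \<Longrightarrow> x \<in> P \<Longrightarrow> y \<in> P \<Longrightarrow> j u \<in> hom D' (i x) (i y) \<longleftrightarrow> u \<in> hom D x y"
  using Q by (auto simp: hom_def transport_def j i_eq dom_P cod_P)

lemma comp_D': "u \<in> Q \<Longrightarrow> v \<in> Q \<Longrightarrow> j v \<cdot>\<^bsub>D'\<^esub> j u = j (v \<cdot>\<^bsub>D\<^esub> u)"
  by (simp add: transport_def j)

lemma arity_D': "u \<in> Q \<Longrightarrow> amap (arity D') (j u) = amap (arity D) u"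
  by (simp add: transport_def j)

lemma category_D': "category D'"
proof
  fix f assume "f \<in> Arr D'"
  then show "Dom D' f \<in> Obj D'" "Cod D' f \<in> Obj D'"
    by (auto simp: transport_def j dom_P cod_P)
next
  fix x assume "x \<in> Obj D'"
  then obtain z where z: "z \<in> P" "x = i z" by (auto simp: transport_def)
  then have "Ident D z \<in> hom D z z"
    using category.ident_closed[OF cat_D] P by auto
  then show "Ident D' x \<in> hom D' x x"
    using z by (auto simp: hom_def transport_def i j ident_Q)
next
  fix f x y g z assume "f \<in> hom D' x y" "g \<in> hom D' y z"
  then obtain u v where uv: "u \<in> Q" "f = j u" "x = i (Dom D u)" "y = i (Cod D u)"
      "v \<in> Q" "g = j v" "y = i (Dom D v)" "z = i (Cod D v)"
    by (auto simp: hom_D')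
  then have "Cod D u = Dom D v" by (metis i dom_P cod_P)
  then show "g \<cdot>\<^bsub>D'\<^esub> f \<in> hom D' x z"
    unfolding hom_D'
    using uv Q comp_Q[of u v] category.comp_arr[OF cat_D, of u v]
    by (intro bexI[of _ "v \<cdot>\<^bsub>D\<^esub> u"]) (simp_all add: comp_D' subset_iff)
next
  fix f x y assume "f \<in> hom D' x y"
  then obtain u where u: "u \<in> Q" "f = j u" "x = i (Dom D u)" "y = i (Cod D u)"
    by (auto simp: hom_D')
  have "u \<in> hom D (Dom D u) (Cod D u)" using u Q by (auto simp: hom_def)
  then have "Ident D (Cod D u) \<cdot>\<^bsub>D\<^esub> u = u" "u \<cdot>\<^bsub>D\<^esub> Ident D (Dom D u) = u"
    using category.ident_left[OF cat_D] category.ident_right[OF cat_D] by auto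
  then show "Ident D' y \<cdot>\<^bsub>D'\<^esub> f = f" "f \<cdot>\<^bsub>D'\<^esub> Ident D' x = f"
    using u by (auto simp: transport_def i j dom_P cod_P ident_Q)
next
  fix f w x g y h z assume "f \<in> hom D' w x" "g \<in> hom D' x y" "h \<in> hom D' y z"
  then obtain u v r where uvr: "u \<in> Q" "f = j u" "w = i (Dom D u)" "x = i (Cod D u)"
      "v \<in> Q" "g = j v" "x = i (Dom D v)" "y = i (Cod D v)"
      "r \<in> Q" "h = j r" "y = i (Dom D r)" "z = i (Cod D r)"
    by (auto simp: hom_D')
  then have eq: "Cod D u = Dom D v" "Cod D v = Dom D r" by (metis i dom_P cod_P)+
  have "(r \<cdot>\<^bsub>D\<^esub> v) \<cdot>\<^bsub>D\<^esub> u = r \<cdot>\<^bsub>D\<^esub> (v \<cdot>\<^bsub>D\<^esub> u)"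
    by (rule category.comp_assoc[OF cat_D, of _ "Dom D u" "Dom D v" _ "Dom D r" _ "Cod D r"])
      (use uvr eq Q in \<open>auto simp: hom_def\<close>)
  then show "(h \<cdot>\<^bsub>D'\<^esub> g) \<cdot>\<^bsub>D'\<^esub> f = h \<cdot>\<^bsub>D'\<^esub> (g \<cdot>\<^bsub>D'\<^esub> f)"
    using uvr eq by (simp add: comp_D' comp_Q)
qed

lemma surcategory_D': "surcategory S D'"
proof -
  have "is_functor D S (arity D)" using D by (simp add: surcategory_def)
  then have "is_functor D' S (arity D')"
    using P Q unfolding is_functor_def
    by (auto simp: transport_def i j i_eq dom_P cod_P ident_Q comp_Q subset_iff)
  then show ?thesis using D category_D' by (simp add: surcategory_def)
qed

lemma surfunctor_D':
  assumes "surcategory S E" "surfunctor S E D H"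
    and HP: "\<And>x. x \<in> Obj E \<Longrightarrow> omap H x \<in> P" and HQ: "\<And>u. u \<in> Arr E \<Longrightarrow> amap H u \<in> Q"
  shows "surfunctor S E D' \<lparr>omap = i \<circ> omap H, amap = j \<circ> amap H\<rparr>"
proof -
  interpret E: category E using assms(1) by (simp add: surcategory_def)
  have "Dom D (amap H u) = omap H (Dom E u)" "Cod D (amap H u) = omap H (Cod E u)"
    if "u \<in> Arr E" for u
    using assms(2) that by (auto simp: surfunctor_def is_functor_def hom_def)
  then show ?thesis
    using assms(2) HP HQ E.dom_closed E.cod_closed
    unfolding surfunctor_def is_functor_def functor_eq_def
    by (auto simp: fcomp_def transport_def hom_def i j)
qed

end

theorem absolute_preserved:
  fixes E :: "('o, 'a, 'b, 'h) surcat" and D :: "('p, 'c, 'b, 'h) surcat"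
  assumes E: "surcategory S E" and D: "surcategory S D" and H: "surfunctor S E D H"
    and abs: "absolute_surcoequalizer S E B a b f g c q"
  shows "surcoequalizer S D B (omap H a) (omap H b) (amap H f) (amap H g) (omap H c) (amap H q)"
proof -
  interpret E: category E using E by (simp add: surcategory_def)
  interpret D: category D using D by (simp add: surcategory_def)
  have H_obj: "\<And>x. x \<in> Obj E \<Longrightarrow> omap H x \<in> Obj D"
    and H_arr: "\<And>u. u \<in> Arr E \<Longrightarrow> amap H u \<in> hom D (omap H (Dom E u)) (omap H (Cod E u))"
    and H_ident: "\<And>x. x \<in> Obj E \<Longrightarrow> amap H (Ident E x) = Ident D (omap H x)"
    and H_comp: "\<And>u v. u \<in> Arr E \<Longrightarrow> v \<in> Arr E \<Longrightarrow> Cod E u = Dom E v \<Longrightarrow>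
        amap H (v \<cdot>\<^bsub>E\<^esub> u) = amap H v \<cdot>\<^bsub>D\<^esub> amap H u"
    and H_arity: "\<And>x. x \<in> Obj E \<Longrightarrow> omap (arity D) (omap H x) = omap (arity E) x"
        "\<And>u. u \<in> Arr E \<Longrightarrow> amap (arity D) (amap H u) = amap (arity E) u"
    using H by (auto simp: surfunctor_def is_functor_def functor_eq_def fcomp_def)
  have surcoeq: "surcoequalizer S E B a b f g c q"
    using abs by (simp add: absolute_surcoequalizer_def)
  have B: "B \<in> Obj S"
    and fgq: "f \<in> hom (fiber S E B) a b" "g \<in> hom (fiber S E B) a b" "q \<in> hom (fiber S E B) b c"
    and eq: "q \<cdot>\<^bsub>E\<^esub> f = q \<cdot>\<^bsub>E\<^esub> g"
    using surcoeq by (auto simp: surcoequalizer_def parallel_pair_def)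
  have arr: "f \<in> Arr E" "g \<in> Arr E" "q \<in> Arr E"
    and ends: "Dom E f = a" "Cod E f = b" "Dom E g = a" "Cod E g = b" "Dom E q = b" "Cod E q = c"
    using fgq by (auto simp: hom_def fiber_def)
  have obj: "b \<in> Obj E" "c \<in> Obj E"
    using arr ends E.dom_closed E.cod_closed by metis+
  have H_fiber: "amap H u \<in> hom (fiber S D B) (omap H x) (omap H y)"
    if "u \<in> hom (fiber S E B) x y" for u x y
    using that H_arr[of u] H_arity by (auto simp: hom_def fiber_def)
  let ?sol = "\<lambda>y q' k. k \<in> hom D (omap H c) y \<and> amap (arity D) k = amap (arity D) q' \<and>
                k \<cdot>\<^bsub>D\<^esub> amap H q = q'"
  have key: "(\<exists>k. ?sol y q' k) \<and> (?sol y q' k1 \<longrightarrow> ?sol y q' k2 \<longrightarrow> k1 = k2)"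
    if q': "q' \<in> hom D (omap H b) y" and q'_eq: "q' \<cdot>\<^bsub>D\<^esub> amap H f = q' \<cdot>\<^bsub>D\<^esub> amap H g"
      and k12: "{k1, k2} \<subseteq> insert q' (hom D (omap H c) y)" for y q' k1 k2
  proof -
    have y: "y \<in> Obj D" using q' D.cod_closed by (auto simp: hom_def)
    define l :: "'a + nat \<Rightarrow> 'c" where
      "l = (\<lambda>w. case w of
               Inl u \<Rightarrow> if u \<in> Arr E then amap H u else q'
             | Inr n \<Rightarrow> if n = 0 then Ident D y else if n = 1 then k1 else if n = 2 then k2 else q')"
    have l_range: "range l \<subseteq> amap H ` Arr E \<union> {Ident D y, k1, k2, q'}"
      by (auto simp: l_def split: sum.splits)
    have in_l: "amap H u \<in> range l" if "u \<in> Arr E" for u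
      using that by (intro range_eqI[of _ _ "Inl u"]) (simp add: l_def)
    have in_l': "Ident D y \<in> range l" "k1 \<in> range l" "k2 \<in> range l" "q' \<in> range l"
      using range_eqI[of _ l "Inr 0"] range_eqI[of _ l "Inr 1"]
        range_eqI[of _ l "Inr 2"] range_eqI[of _ l "Inr 3"]
      by (simp_all add: l_def)
    define P where "P = insert y (omap H ` Obj E)"
    define Q where "Q = generated D (range l)"
    define io :: "'o option \<Rightarrow> 'p" where "io = case_option y (omap H)"
    have l_arr: "v \<in> Arr D \<and> Dom D v \<in> P \<and> Cod D v \<in> P" if "v \<in> range l" for v
    proof -
      have "v \<in> amap H ` Arr E \<or> v = Ident D y \<or> v \<in> hom D (omap H b) y \<or> v \<in> hom D (omap H c) y"
        using that l_range q' k12 by auto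
      then show ?thesis
        using D.ident_closed[OF y] H_arr E.dom_closed E.cod_closed obj
        by (auto simp: P_def hom_def)
    qed
    then have l_sub: "range l \<subseteq> Arr D" by blast
    have Q_arr: "Q \<subseteq> Arr D"
      using D.generated_arr[OF l_sub] by (auto simp: Q_def)
    have Q_ends: "Dom D v \<in> P \<and> Cod D v \<in> P" if "v \<in> Q" for v
      using that unfolding Q_def
    proof induction
      case (step u v)
      then show ?case
        using l_arr D.generated_arr[OF l_sub] D.comp_arr[of u v] by auto
    qed (use l_arr in auto)
    have in_Q: "v \<in> Q" if "v \<in> range l" for v
      using that by (auto simp: Q_def intro: generated.base)
    have P_io: "P \<subseteq> range io"
      by (auto simp: P_def io_def intro: range_eqI[of _ _ None] range_eqI[of _ _ "Some _"])
    have Q_wd: "Q \<subseteq> range (word_value D l)"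
      unfolding Q_def by (rule generated_words)
    let ?i = "inv io" and ?j = "inv (word_value D l)"
    interpret tr: transported_subcategory S D P Q ?i io ?j "word_value D l"
    proof
      fix x assume "x \<in> P"
      then show "Ident D x \<in> Q"
        using in_Q in_l in_l' H_ident E.ident_closed
        by (auto simp: P_def hom_def) (metis (no_types, lifting))
    next
      fix u v assume "u \<in> Q" "v \<in> Q" "Cod D u = Dom D v"
      then show "v \<cdot>\<^bsub>D\<^esub> u \<in> Q" using D.generated_comp[OF l_sub] by (simp add: Q_def)
    next
      fix x assume "x \<in> P"
      then show "io (?i x) = x" using P_io by (intro f_inv_into_f) auto
    next
      fix u assume "u \<in> Q"
      then show "word_value D l (?j u) = u" using Q_wd by (intro f_inv_into_f) auto
    qed (use D y H_obj Q_arr Q_ends in \<open>auto simp: P_def\<close>)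
    have HP: "\<And>x. x \<in> Obj E \<Longrightarrow> omap H x \<in> P" and HQ: "\<And>u. u \<in> Arr E \<Longrightarrow> amap H u \<in> Q"
      using in_Q in_l by (auto simp: P_def)
    note H' = tr.surfunctor_D'[OF E H HP HQ]
    have yP: "y \<in> P" and q'Q: "q' \<in> Q" "k1 \<in> Q" "k2 \<in> Q"
      using in_Q in_l' by (auto simp: P_def)
    have "surcoequalizer S tr.D' B (?i (omap H a)) (?i (omap H b)) (?j (amap H f)) (?j (amap H g))
        (?i (omap H c)) (?j (amap H q))"
      using abs tr.surcategory_D' H' unfolding absolute_surcoequalizer_def by force
    moreover have "?j q' \<in> hom tr.D' (?i (omap H b)) (?i y)"
      using tr.hom_D'_j q'Q yP HP obj q' by auto
    moreover have "?j q' \<cdot>\<^bsub>tr.D'\<^esub> ?j (amap H f) = ?j q' \<cdot>\<^bsub>tr.D'\<^esub> ?j (amap H g)"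
      using tr.comp_D' q'Q HQ arr q'_eq by auto
    ultimately have ex1: "\<exists>!k. k \<in> hom tr.D' (?i (omap H c)) (?i y) \<and>
        amap (arity tr.D') k = amap (arity tr.D') (?j q') \<and> k \<cdot>\<^bsub>tr.D'\<^esub> ?j (amap H q) = ?j q'"
      unfolding surcoequalizer_def by blast
    have sol_iff: "?j k \<in> hom tr.D' (?i (omap H c)) (?i y) \<and>
        amap (arity tr.D') (?j k) = amap (arity tr.D') (?j q') \<and>
        ?j k \<cdot>\<^bsub>tr.D'\<^esub> ?j (amap H q) = ?j q' \<longleftrightarrow> ?sol y q' k" if "k \<in> Q" for k
    proof (cases "k \<in> hom D (omap H c) y")
      case True
      have "Cod D (amap H q) = Dom D k" using True H_arr[OF arr(3)] ends by (simp add: hom_def)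
      then have "k \<cdot>\<^bsub>D\<^esub> amap H q \<in> Q" using tr.comp_Q HQ arr that by blast
      then show ?thesis
        using that q'Q HQ[OF arr(3)] HP[OF obj(2)] yP
        by (simp add: tr.hom_D'_j tr.arity_D' tr.comp_D' tr.j_eq)
    next
      case False
      then show ?thesis
        using that HP[OF obj(2)] yP by (simp add: tr.hom_D'_j)
    qed
    have "\<exists>k. ?sol y q' k"
    proof -
      obtain k' where k': "k' \<in> hom tr.D' (?i (omap H c)) (?i y) \<and>
        amap (arity tr.D') k' = amap (arity tr.D') (?j q') \<and> k' \<cdot>\<^bsub>tr.D'\<^esub> ?j (amap H q) = ?j q'"
        using ex1 by blast
      then obtain k where "k \<in> Q" "k' = ?j k" using tr.hom_D' by blast
      then show ?thesis using sol_iff k' by blast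
    qed
    moreover have "k1 = k2" if "?sol y q' k1" "?sol y q' k2"
    proof -
      have "?j k1 = ?j k2"
        using ex1 sol_iff[OF q'Q(2)] sol_iff[OF q'Q(3)] that by blast
      then show ?thesis using tr.j_eq q'Q by blast
    qed
    ultimately show ?thesis by blast
  qed
  have "\<exists>!k. ?sol y q' k"
    if q': "q' \<in> hom D (omap H b) y" "q' \<cdot>\<^bsub>D\<^esub> amap H f = q' \<cdot>\<^bsub>D\<^esub> amap H g" for y q'
  proof -
    have "\<exists>k. ?sol y q' k" using key[OF q', of q' q'] by blast
    moreover have "k1 = k2" if "?sol y q' k1" "?sol y q' k2" for k1 k2
      using key[OF q', of k1 k2] that by blast
    ultimately show ?thesis by blast
  qed
  moreover have "amap H q \<cdot>\<^bsub>D\<^esub> amap H f = amap H q \<cdot>\<^bsub>D\<^esub> amap H g"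
    using H_comp[of f q] H_comp[of g q] arr ends eq by simp
  ultimately show ?thesis
    using B H_fiber fgq by (auto simp: surcoequalizer_def parallel_pair_def)
qed

section \<open>Well-definedness of the induced surmonad and the comparison\<close>

lemma induced_surmonad:
  assumes A: "surcategory S A" and X: "surcategory S X" and adj: "suradjunction S A X F G \<eta> \<epsilon>"
  shows "surmonad S X (induced_monad F G \<eta> \<epsilon>)"
proof -
  interpret S: category S using A by (simp add: surcategory_def)
  interpret A: category A using A by (simp add: surcategory_def)
  interpret X: category X using X by (simp add: surcategory_def)
  have F: "\<And>x. x \<in> Obj X \<Longrightarrow> omap F x \<in> Obj A"
    "\<And>u. u \<in> Arr X \<Longrightarrow> amap F u \<in> Arr A"
    "\<And>u. u \<in> Arr X \<Longrightarrow> Dom A (amap F u) = omap F (Dom X u)"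
    "\<And>u. u \<in> Arr X \<Longrightarrow> Cod A (amap F u) = omap F (Cod X u)"
    "\<And>x. x \<in> Obj X \<Longrightarrow> amap F (Ident X x) = Ident A (omap F x)"
    "\<And>u v. u \<in> Arr X \<Longrightarrow> v \<in> Arr X \<Longrightarrow> Cod X u = Dom X v \<Longrightarrow>
        amap F (v \<cdot>\<^bsub>X\<^esub> u) = amap F v \<cdot>\<^bsub>A\<^esub> amap F u"
    "\<And>x. x \<in> Obj X \<Longrightarrow> omap (arity A) (omap F x) = omap (arity X) x"
    "\<And>u. u \<in> Arr X \<Longrightarrow> amap (arity A) (amap F u) = amap (arity X) u"
    using adj by (auto simp: suradjunction_def surfunctor_def is_functor_def functor_eq_def fcomp_def hom_def)
  have G: "\<And>x. x \<in> Obj A \<Longrightarrow> omap G x \<in> Obj X"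
    "\<And>u. u \<in> Arr A \<Longrightarrow> amap G u \<in> Arr X"
    "\<And>u. u \<in> Arr A \<Longrightarrow> Dom X (amap G u) = omap G (Dom A u)"
    "\<And>u. u \<in> Arr A \<Longrightarrow> Cod X (amap G u) = omap G (Cod A u)"
    "\<And>x. x \<in> Obj A \<Longrightarrow> amap G (Ident A x) = Ident X (omap G x)"
    "\<And>u v. u \<in> Arr A \<Longrightarrow> v \<in> Arr A \<Longrightarrow> Cod A u = Dom A v \<Longrightarrow>
        amap G (v \<cdot>\<^bsub>A\<^esub> u) = amap G v \<cdot>\<^bsub>X\<^esub> amap G u"
    "\<And>x. x \<in> Obj A \<Longrightarrow> omap (arity X) (omap G x) = omap (arity A) x"
    "\<And>u. u \<in> Arr A \<Longrightarrow> amap (arity X) (amap G u) = amap (arity A) u"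
    using adj by (auto simp: suradjunction_def surfunctor_def is_functor_def functor_eq_def fcomp_def hom_def)
  have e: "\<And>x. x \<in> Obj A \<Longrightarrow> \<epsilon> x \<in> Arr A"
    "\<And>x. x \<in> Obj A \<Longrightarrow> Dom A (\<epsilon> x) = omap F (omap G x)"
    "\<And>x. x \<in> Obj A \<Longrightarrow> Cod A (\<epsilon> x) = x"
    "\<And>x. x \<in> Obj A \<Longrightarrow> amap (arity A) (\<epsilon> x) = Ident S (omap (arity A) x)"
    "\<And>u. u \<in> Arr A \<Longrightarrow> \<epsilon> (Cod A u) \<cdot>\<^bsub>A\<^esub> amap F (amap G u) = u \<cdot>\<^bsub>A\<^esub> \<epsilon> (Dom A u)"
    "\<And>x. x \<in> Obj A \<Longrightarrow> amap G (\<epsilon> x) \<cdot>\<^bsub>X\<^esub> \<eta> (omap G x) = Ident X (omap G x)"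
    using adj by (auto simp: suradjunction_def surnat_def fcomp_def fid_def hom_def)
  have n: "\<And>x. x \<in> Obj X \<Longrightarrow> \<eta> x \<in> Arr X"
    "\<And>x. x \<in> Obj X \<Longrightarrow> Dom X (\<eta> x) = x"
    "\<And>x. x \<in> Obj X \<Longrightarrow> Cod X (\<eta> x) = omap G (omap F x)"
    "\<And>x. x \<in> Obj X \<Longrightarrow> amap (arity X) (\<eta> x) = Ident S (omap (arity X) x)"
    "\<And>u. u \<in> Arr X \<Longrightarrow> \<eta> (Cod X u) \<cdot>\<^bsub>X\<^esub> u = amap G (amap F u) \<cdot>\<^bsub>X\<^esub> \<eta> (Dom X u)"
    "\<And>x. x \<in> Obj X \<Longrightarrow> \<epsilon> (omap F x) \<cdot>\<^bsub>A\<^esub> amap F (\<eta> x) = Ident A (omap F x)"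
    using adj by (auto simp: suradjunction_def surnat_def fcomp_def fid_def hom_def)
  note [simp] = F G e(1-4,6) n(1-4,6) X.dom_closed X.cod_closed A.dom_closed A.cod_closed
  have G_comp: "amap G v \<cdot>\<^bsub>X\<^esub> amap G u = amap G (v \<cdot>\<^bsub>A\<^esub> u)"
    if "u \<in> Arr A" "v \<in> Arr A" "Cod A u = Dom A v" for u v using that by simp
  have nat: "amap G (\<epsilon> (omap F (Cod X u))) \<cdot>\<^bsub>X\<^esub> amap G (amap F (amap G (amap F u))) =
      amap G (amap F u) \<cdot>\<^bsub>X\<^esub> amap G (\<epsilon> (omap F (Dom X u)))" if "u \<in> Arr X" for u
    using e(5)[of "amap F u"] that by (simp add: G_comp del: G(6))
  have asc: "amap G (\<epsilon> (omap F x)) \<cdot>\<^bsub>X\<^esub> amap G (\<epsilon> (omap F (omap G (omap F x)))) =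
      amap G (\<epsilon> (omap F x)) \<cdot>\<^bsub>X\<^esub> amap G (amap F (amap G (\<epsilon> (omap F x))))" if "x \<in> Obj X" for x
    using e(5)[of "\<epsilon> (omap F x)"] that by (simp add: G_comp del: G(6))
  have un: "amap G (\<epsilon> (omap F x)) \<cdot>\<^bsub>X\<^esub> amap G (amap F (\<eta> x)) = Ident X (omap G (omap F x))" if "x \<in> Obj X" for x
    using that by (simp add: G_comp del: G(6))
  show ?thesis
    unfolding surmonad_def surfunctor_def is_functor_def functor_eq_def surnat_def induced_monad_def
    using n(5) nat asc un
    by (simp add: fcomp_def fid_def hom_def)
qed

lemma surcategory_EM:
  assumes X: "surcategory S X" and T: "surmonad S X T"
  shows "surcategory S (EM X T)"
proof -
  interpret X: category X using X by (simp add: surcategory_def)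
  have T: "\<And>x. x \<in> Obj X \<Longrightarrow> omap (endo T) x \<in> Obj X"
    "\<And>u. u \<in> Arr X \<Longrightarrow> amap (endo T) u \<in> Arr X"
    "\<And>u. u \<in> Arr X \<Longrightarrow> Dom X (amap (endo T) u) = omap (endo T) (Dom X u)"
    "\<And>u. u \<in> Arr X \<Longrightarrow> Cod X (amap (endo T) u) = omap (endo T) (Cod X u)"
    "\<And>x. x \<in> Obj X \<Longrightarrow> amap (endo T) (Ident X x) = Ident X (omap (endo T) x)"
    "\<And>u v. u \<in> Arr X \<Longrightarrow> v \<in> Arr X \<Longrightarrow> Cod X u = Dom X v \<Longrightarrow>
        amap (endo T) (v \<cdot>\<^bsub>X\<^esub> u) = amap (endo T) v \<cdot>\<^bsub>X\<^esub> amap (endo T) u"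
    using T by (auto simp: surmonad_def surfunctor_def is_functor_def hom_def)
  have id: "Ident X x \<in> Arr X" "Dom X (Ident X x) = x" "Cod X (Ident X x) = x" if "x \<in> Obj X" for x
    using X.ident_closed[OF that] by (auto simp: hom_def)
  have l: "Ident X (Cod X u) \<cdot>\<^bsub>X\<^esub> u = u" "u \<cdot>\<^bsub>X\<^esub> Ident X (Dom X u) = u" if "u \<in> Arr X" for u
    using X.ident_left[of u "Dom X u" "Cod X u"] X.ident_right[of u "Dom X u" "Cod X u"] that by (auto simp: hom_def)
  have asc: "(w \<cdot>\<^bsub>X\<^esub> v) \<cdot>\<^bsub>X\<^esub> u = w \<cdot>\<^bsub>X\<^esub> (v \<cdot>\<^bsub>X\<^esub> u)"
    if "u \<in> Arr X" "v \<in> Arr X" "w \<in> Arr X" "Cod X u = Dom X v" "Cod X v = Dom X w" for u v w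
    using X.comp_assoc[of u "Dom X u" "Cod X u" v "Cod X v" w "Cod X w"] that by (auto simp: hom_def)
  have cl: "(g \<cdot>\<^bsub>X\<^esub> f) \<cdot>\<^bsub>X\<^esub> h = l \<cdot>\<^bsub>X\<^esub> amap (endo T) (g \<cdot>\<^bsub>X\<^esub> f)"
    if "(x,h) \<in> algebras X T" "(y,k) \<in> algebras X T" "(z,l) \<in> algebras X T" 
     "f \<in> hom X x y" "g \<in> hom X y z" "f \<cdot>\<^bsub>X\<^esub> h = k \<cdot>\<^bsub>X\<^esub> amap (endo T) f" "g \<cdot>\<^bsub>X\<^esub> k = l \<cdot>\<^bsub>X\<^esub> amap (endo T) g"
   for x h y k z l f g
  proof -
    have "(g \<cdot>\<^bsub>X\<^esub> f) \<cdot>\<^bsub>X\<^esub> h = g \<cdot>\<^bsub>X\<^esub> (k \<cdot>\<^bsub>X\<^esub> amap (endo T) f)"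
      using that by (simp add: asc hom_def algebras_def)
    also have "\<dots> = (g \<cdot>\<^bsub>X\<^esub> k) \<cdot>\<^bsub>X\<^esub> amap (endo T) f"
      using that by (intro asc[symmetric]) (auto simp: hom_def algebras_def T)
    also have "\<dots> = (l \<cdot>\<^bsub>X\<^esub> amap (endo T) g) \<cdot>\<^bsub>X\<^esub> amap (endo T) f" using that by simp
    also have "\<dots> = l \<cdot>\<^bsub>X\<^esub> (amap (endo T) g \<cdot>\<^bsub>X\<^esub> amap (endo T) f)"
      using that by (intro asc) (auto simp: hom_def algebras_def T)
    also have "\<dots> = l \<cdot>\<^bsub>X\<^esub> amap (endo T) (g \<cdot>\<^bsub>X\<^esub> f)"
      using that by (simp add: T hom_def)
    finally show ?thesis .
  qed
  have ar: "is_functor X S (arity X)" using X by (simp add: surcategory_def)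
  have "category (EM X T)"
  proof
    fix p assume "p \<in> Obj (EM X T)"
    then show "Ident (EM X T) p \<in> hom (EM X T) p p"
      by (cases p) (simp add: EM_def hom_def id algebras_def T, metis l T)
  next
    fix f x y g z assume "f \<in> hom (EM X T) x y" "g \<in> hom (EM X T) y z"
    then show "g \<cdot>\<^bsub>EM X T\<^esub> f \<in> hom (EM X T) x z"
      using cl by (auto simp: EM_def hom_def X.comp_arr)
  qed (auto simp: EM_def hom_def l asc)
  moreover have "is_functor (EM X T) S (arity (EM X T))"
    using ar unfolding is_functor_def
    by (simp add: EM_def algebras_def hom_def split_beta)
  ultimately show ?thesis using X by (simp add: surcategory_def)
qed

text \<open>The comparison predicate is satisfied by the usual \<open>K a = (G a, G (\<epsilon> a))\<close>.\<close>

lemma comparison_exists: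
  assumes A: "surcategory S A" and X: "surcategory S X" and adj: "suradjunction S A X F G \<eta> \<epsilon>"
  defines "K \<equiv> \<lparr>omap = \<lambda>a. (omap G a, amap G (\<epsilon> a)),
     amap = \<lambda>f. ((omap G (Dom A f), amap G (\<epsilon> (Dom A f))), amap G f,
                   (omap G (Cod A f), amap G (\<epsilon> (Cod A f))))\<rparr>"
  shows "comparison S A X F G (induced_monad F G \<eta> \<epsilon>) K"
proof -
  interpret A: category A using A by (simp add: surcategory_def)
  interpret X: category X using X by (simp add: surcategory_def)
  have F: "\<And>x. x \<in> Obj X \<Longrightarrow> omap F x \<in> Obj A"
    "\<And>u. u \<in> Arr X \<Longrightarrow> amap F u \<in> Arr A"
    "\<And>u. u \<in> Arr X \<Longrightarrow> Dom A (amap F u) = omap F (Dom X u)"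
    "\<And>u. u \<in> Arr X \<Longrightarrow> Cod A (amap F u) = omap F (Cod X u)"
    using adj by (auto simp: suradjunction_def surfunctor_def is_functor_def functor_eq_def fcomp_def hom_def)
  have G: "\<And>x. x \<in> Obj A \<Longrightarrow> omap G x \<in> Obj X"
    "\<And>u. u \<in> Arr A \<Longrightarrow> amap G u \<in> Arr X"
    "\<And>u. u \<in> Arr A \<Longrightarrow> Dom X (amap G u) = omap G (Dom A u)"
    "\<And>u. u \<in> Arr A \<Longrightarrow> Cod X (amap G u) = omap G (Cod A u)"
    "\<And>x. x \<in> Obj A \<Longrightarrow> amap G (Ident A x) = Ident X (omap G x)"
    "\<And>u v. u \<in> Arr A \<Longrightarrow> v \<in> Arr A \<Longrightarrow> Cod A u = Dom A v \<Longrightarrow>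
        amap G (v \<cdot>\<^bsub>A\<^esub> u) = amap G v \<cdot>\<^bsub>X\<^esub> amap G u"
    "\<And>x. x \<in> Obj A \<Longrightarrow> omap (arity X) (omap G x) = omap (arity A) x"
    "\<And>u. u \<in> Arr A \<Longrightarrow> amap (arity X) (amap G u) = amap (arity A) u"
    using adj by (auto simp: suradjunction_def surfunctor_def is_functor_def functor_eq_def fcomp_def hom_def)
  have e: "\<And>x. x \<in> Obj A \<Longrightarrow> \<epsilon> x \<in> Arr A"
    "\<And>x. x \<in> Obj A \<Longrightarrow> Dom A (\<epsilon> x) = omap F (omap G x)"
    "\<And>x. x \<in> Obj A \<Longrightarrow> Cod A (\<epsilon> x) = x"
    "\<And>u. u \<in> Arr A \<Longrightarrow> \<epsilon> (Cod A u) \<cdot>\<^bsub>A\<^esub> amap F (amap G u) = u \<cdot>\<^bsub>A\<^esub> \<epsilon> (Dom A u)"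
    "\<And>x. x \<in> Obj A \<Longrightarrow> amap G (\<epsilon> x) \<cdot>\<^bsub>X\<^esub> \<eta> (omap G x) = Ident X (omap G x)"
    using adj by (auto simp: suradjunction_def surnat_def fcomp_def fid_def hom_def)
  note [simp] = F G(1-5,7-) e(1-3,5) X.dom_closed X.cod_closed A.dom_closed A.cod_closed
  have id: "Ident A x \<in> Arr A" "Dom A (Ident A x) = x" "Cod A (Ident A x) = x" if "x \<in> Obj A" for x
    using A.ident_closed[OF that] by (auto simp: hom_def)
  have alg: "(omap G a, amap G (\<epsilon> a)) \<in> algebras X (induced_monad F G \<eta> \<epsilon>)" if "a \<in> Obj A" for a
    using that e(4)[of "\<epsilon> a"] by (simp add: algebras_def induced_monad_def fcomp_def hom_def G(6)[symmetric])
  have "amap K u \<in> Arr (EM X (induced_monad F G \<eta> \<epsilon>))" if "u \<in> Arr A" for u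
    using that alg e(4)[of u] by (simp add: K_def EM_def hom_def induced_monad_def fcomp_def G(6)[symmetric])
  then have "surfunctor S A (EM X (induced_monad F G \<eta> \<epsilon>)) K"
    using alg by (auto simp: surfunctor_def is_functor_def functor_eq_def fcomp_def EM_def K_def hom_def id A.comp_arr G(6))
  then show ?thesis
    by (auto simp: comparison_def functor_eq_def fcomp_def K_def forget_EM_def free_EM_def induced_monad_def)
qed

end

theory Submission
  imports Defs
begin

text \<open>
  This is Beck's monadicity theorem relative to a base category. Since \<open>G\<^sup>T K = G\<close> and
  \<open>K F = F\<^sup>T\<close>, the comparison must send \<open>a\<close> to the algebra \<open>(G a, G \<epsilon>\<^sub>a)\<close> (lemma \<open>K_obj\<close>), so that
  it is an isomorphism iff it is bijective on objects and on arrows.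

  Suppose \<open>G\<close> creates surcoequalizers for split forks. Every algebra \<open>(x, h)\<close> is the end of
  the fork \<open>GFGFx \<rightrightarrows> GFx \<rightarrow> x\<close> with pair \<open>G \<epsilon>\<^sub>F\<^sub>x, GFh\<close>, which is split by units and whose pair is the
  image of \<open>\<epsilon>\<^sub>F\<^sub>x, Fh\<close>. The created object \<open>c\<close> satisfies \<open>G \<epsilon>\<^sub>c = h\<close>, and the created arrow is
  \<open>\<epsilon>\<^sub>c\<close> itself (\<open>lift_algebra\<close>). This gives bijectivity on objects. It also shows that each
  \<open>\<epsilon>\<^sub>a\<close> is a surcoequalizer, and its universal property, applied to \<open>\<epsilon>\<^sub>b \<circ> Fu\<close>, turns an algebra
  homomorphism \<open>u : G a \<rightarrow> G b\<close> into a unique arrow \<open>a \<rightarrow> b\<close>.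

  Suppose that \<open>K\<close> is an isomorphism, and let \<open>e : G b \<rightarrow> z\<close> be an absolute surcoequalizer of
  \<open>G f, G g\<close>. The endofunctors \<open>GF\<close> and \<open>GFGF\<close> preserve it, which is exactly what is needed to
  descend the structure \<open>G \<epsilon>\<^sub>b\<close> along \<open>e\<close> to a structure on \<open>z\<close> and to check the associativity law
  (\<open>absolute_surcoequalizer_algebra\<close>). The surcoequalizer in \<open>A\<close> is the preimage under \<open>K\<close>.

  Finally, a split fork is an equational condition that makes its last arrow a surcoequalizer, so
  split surcoequalizers are absolute (\<open>split_absolute\<close>) and creation for absolute ones
  implies creation for split ones.

  Arities matter in one respect: a surcoequalizer is epic only with respect to pairs of arrows with
  the same arity (\<open>surcoequalizer_cancel\<close>). All structure arrows are vertical, that is, they lie over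
  identities, so the arities always agree where this cancellation is used.
\<close>

section \<open>Calculating in categories and surcategories\<close>

context category
begin

lemma assoc:
  "\<lbrakk>u \<in> Arr C; v \<in> Arr C; w \<in> Arr C; Cod C u = Dom C v; Cod C v = Dom C w\<rbrakk> \<Longrightarrow>
    (w \<cdot> v) \<cdot> u = w \<cdot> (v \<cdot> u)"
  using comp_assoc[of u "Dom C u" "Cod C u" v "Cod C v" w "Cod C w"] by (auto simp: hom_def)

lemma ident_arr:
  assumes "x \<in> Obj C"
  shows "Ident C x \<in> Arr C" "Dom C (Ident C x) = x" "Cod C (Ident C x) = x"
  using ident_closed[OF assms] by (auto simp: hom_def)

lemma ident_cancel:
  "\<lbrakk>u \<in> Arr C; Cod C u = y\<rbrakk> \<Longrightarrow> Ident C y \<cdot> u = u"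
  "\<lbrakk>u \<in> Arr C; Dom C u = x\<rbrakk> \<Longrightarrow> u \<cdot> Ident C x = u"
  using ident_left[of u "Dom C u" y] ident_right[of u x "Cod C u"] by (auto simp: hom_def)

lemmas category_simps = assoc ident_arr ident_cancel comp_arr dom_closed cod_closed

end

lemma is_functor_simps:
  assumes "is_functor C D H"
  shows "x \<in> Obj C \<Longrightarrow> omap H x \<in> Obj D"
    and "u \<in> Arr C \<Longrightarrow> amap H u \<in> Arr D"
    and "u \<in> Arr C \<Longrightarrow> Dom D (amap H u) = omap H (Dom C u)"
    and "u \<in> Arr C \<Longrightarrow> Cod D (amap H u) = omap H (Cod C u)"
    and "x \<in> Obj C \<Longrightarrow> amap H (Ident C x) = Ident D (omap H x)"
    and "\<lbrakk>u \<in> Arr C; v \<in> Arr C; Cod C u = Dom C v\<rbrakk> \<Longrightarrow>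
      amap H (v \<cdot>\<^bsub>C\<^esub> u) = amap H v \<cdot>\<^bsub>D\<^esub> amap H u"
  using assms by (auto simp: is_functor_def hom_def)

lemma surfunctor_simps:
  assumes "surfunctor S E D H"
  shows "is_functor E D H"
    and "x \<in> Obj E \<Longrightarrow> omap (arity D) (omap H x) = omap (arity E) x"
    and "u \<in> Arr E \<Longrightarrow> amap (arity D) (amap H u) = amap (arity E) u"
  using assms by (auto simp: surfunctor_def functor_eq_def fcomp_def)

lemma surcategory_simps:
  assumes "surcategory S E"
  shows "category S" "category E" "is_functor E S (arity E)"
  using assms by (auto simp: surcategory_def)

lemma vertical_over:
  assumes E: "surcategory S E" and B: "B \<in> Obj S"
    and u: "u \<in> hom (fiber S E B) x y"
  shows "omap (arity E) x = B" "omap (arity E) y = B"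
proof -
  interpret S: category S by (rule surcategory_simps[OF E])
  note ar = is_functor_simps[OF surcategory_simps(3)[OF E]]
  show "omap (arity E) x = B" "omap (arity E) y = B"
    using u ar(3,4)[of u] S.ident_arr[OF B] by (auto simp: hom_def fiber_def)
qed

lemma surfunctor_fiber:
  assumes "surfunctor S E D H" "u \<in> hom (fiber S E B) x y"
  shows "amap H u \<in> hom (fiber S D B) (omap H x) (omap H y)"
  using assms is_functor_simps[OF surfunctor_simps(1)[OF assms(1)]] surfunctor_simps[OF assms(1)]
  by (auto simp: hom_def fiber_def)

lemma surfunctor_fcomp:
  assumes "surfunctor S C D H" "surfunctor S D E L"
  shows "surfunctor S C E (L \<circ>\<^sub>F H)"
  using is_functor_simps[OF surfunctor_simps(1)[OF assms(1)]] surfunctor_simps(2,3)[OF assms(1)]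
    is_functor_simps[OF surfunctor_simps(1)[OF assms(2)]] surfunctor_simps(2,3)[OF assms(2)]
  by (simp add: surfunctor_def is_functor_def functor_eq_def fcomp_def hom_def)

text \<open>The inverse of a bijective functor is automatically a surfunctor. Here inverses of functions
  on carriers supply the inverse functor, so that the isomorphism condition becomes one
  on sets.\<close>

lemma sur_isomorphism_iff_bij:
  assumes E: "surcategory S E" and D: "surcategory S D" and H: "surfunctor S E D H"
  shows "sur_isomorphism S E D H \<longleftrightarrow>
    bij_betw (omap H) (Obj E) (Obj D) \<and> bij_betw (amap H) (Arr E) (Arr D)"
proof
  note H_simps = is_functor_simps[OF surfunctor_simps(1)[OF H]] surfunctor_simps(2,3)[OF H]
  show "bij_betw (omap H) (Obj E) (Obj D) \<and> bij_betw (amap H) (Arr E) (Arr D)"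
    if iso: "sur_isomorphism S E D H"
  proof -
    obtain L where L: "surfunctor S D E L" and HL: "functor_eq D (H \<circ>\<^sub>F L) fid"
      and LH: "functor_eq E (L \<circ>\<^sub>F H) fid"
      using iso by (auto simp: sur_isomorphism_def)
    note L_simps = is_functor_simps[OF surfunctor_simps(1)[OF L]]
    have "bij_betw (omap H) (Obj E) (Obj D)"
      using HL LH H_simps L_simps
      by (intro bij_betw_byWitness[where f' = "omap L"]) (auto simp: functor_eq_def fcomp_def fid_def)
    moreover have "bij_betw (amap H) (Arr E) (Arr D)"
      using HL LH H_simps L_simps
      by (intro bij_betw_byWitness[where f' = "amap L"]) (auto simp: functor_eq_def fcomp_def fid_def)
    ultimately show ?thesis by blast
  qed
  show "sur_isomorphism S E D H"
    if bij: "bij_betw (omap H) (Obj E) (Obj D) \<and> bij_betw (amap H) (Arr E) (Arr D)"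
  proof -
    interpret E: category E by (rule surcategory_simps[OF E])
    define L where "L = \<lparr>omap = inv_into (Obj E) (omap H), amap = inv_into (Arr E) (amap H)\<rparr>"
    have inj: "inj_on (omap H) (Obj E)" "inj_on (amap H) (Arr E)"
      and surj: "\<And>y. y \<in> Obj D \<Longrightarrow> \<exists>x \<in> Obj E. y = omap H x"
        "\<And>v. v \<in> Arr D \<Longrightarrow> \<exists>u \<in> Arr E. v = amap H u"
      using bij by (auto simp: bij_betw_def)
    have L_obj: "omap L (omap H x) = x" if "x \<in> Obj E" for x
      using inj that by (simp add: L_def)
    have L_arr: "amap L (amap H u) = u" if "u \<in> Arr E" for u
      using inj that by (simp add: L_def)
    have ends: "Cod D (amap H u) = Dom D (amap H v) \<longleftrightarrow> Cod E u = Dom E v"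
      if "u \<in> Arr E" "v \<in> Arr E" for u v
      using that H_simps inj_on_eq_iff[OF inj(1)] E.dom_closed E.cod_closed by simp
    have "is_functor D E L"
      unfolding is_functor_def
    proof (intro conjI ballI impI)
      fix y assume "y \<in> Obj D"
      then show "omap L y \<in> Obj E" "amap L (Ident D y) = Ident E (omap L y)"
        using surj(1)[of y] L_obj L_arr E.ident_arr(1) by (auto simp: H_simps(5)[symmetric])
    next
      fix v assume "v \<in> Arr D"
      then show "amap L v \<in> hom E (omap L (Dom D v)) (omap L (Cod D v))"
        using surj(2)[of v] L_obj L_arr H_simps E.dom_closed E.cod_closed by (auto simp: hom_def)
    next
      fix v w assume vw: "v \<in> Arr D" "w \<in> Arr D" "Cod D v = Dom D w"
      obtain u u' where u: "u \<in> Arr E" "v = amap H u" "u' \<in> Arr E" "w = amap H u'"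
        using surj(2) vw by meson
      then show "amap L (w \<cdot>\<^bsub>D\<^esub> v) = amap L w \<cdot>\<^bsub>E\<^esub> amap L v"
        using vw(3) ends L_arr E.comp_arr by (simp add: H_simps(6)[symmetric])
    qed
    moreover have "omap (arity E) (omap L y) = omap (arity D) y" if "y \<in> Obj D" for y
      using surj(1)[OF that] L_obj H_simps(7) by auto
    moreover have "amap (arity E) (amap L v) = amap (arity D) v" if "v \<in> Arr D" for v
      using surj(2)[OF that] L_arr H_simps(8) by auto
    ultimately have "surfunctor S D E L"
      by (simp add: surfunctor_def functor_eq_def fcomp_def)
    moreover have "omap H (omap L y) = y" if "y \<in> Obj D" for y
      using surj(1)[OF that] L_obj by auto
    moreover have "amap H (amap L v) = v" if "v \<in> Arr D" for v
      using surj(2)[OF that] L_arr by auto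
    ultimately have "surfunctor S D E L" "functor_eq D (H \<circ>\<^sub>F L) fid" "functor_eq E (L \<circ>\<^sub>F H) fid"
      using L_obj L_arr by (auto simp: functor_eq_def fcomp_def fid_def)
    then show ?thesis
      using H by (auto simp: sur_isomorphism_def)
  qed
qed


section \<open>Split forks are absolute\<close>

text \<open>The purely equational part of a split surcoequalizer, separated from the universal property
  because it is what functors visibly preserve.\<close>

definition split_fork ::
  "('b, 'h) cat \<Rightarrow> ('o, 'a, 'b, 'h) surcat \<Rightarrow> 'b \<Rightarrow> 'o \<Rightarrow> 'o \<Rightarrow> 'a \<Rightarrow> 'a \<Rightarrow> 'o \<Rightarrow> 'a \<Rightarrow> bool" where
  "split_fork S E B a b f g c q \<longleftrightarrow>
     parallel_pair S E B a b f g \<and> q \<in> hom (fiber S E B) b c \<and> q \<cdot>\<^bsub>E\<^esub> f = q \<cdot>\<^bsub>E\<^esub> g \<and>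
     (\<exists>s \<in> hom (fiber S E B) c b. \<exists>t \<in> hom (fiber S E B) b a.
        q \<cdot>\<^bsub>E\<^esub> s = Ident E c \<and> f \<cdot>\<^bsub>E\<^esub> t = Ident E b \<and> g \<cdot>\<^bsub>E\<^esub> t = s \<cdot>\<^bsub>E\<^esub> q)"

text \<open>Any \<open>q'\<close> equalizing the pair factors as \<open>q' s\<close>, because \<open>q' s q = q' g t = q' f t = q'\<close>.
  As \<open>s\<close> is vertical, \<open>q' s\<close> has the arity of \<open>q'\<close>.\<close>

lemma split_fork_surcoequalizer:
  assumes E: "surcategory S E" and fork: "split_fork S E B a b f g c q"
  shows "surcoequalizer S E B a b f g c q"
proof -
  interpret S: category S by (rule surcategory_simps[OF E])
  interpret E: category E by (rule surcategory_simps[OF E])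
  note ar = is_functor_simps[OF surcategory_simps(3)[OF E]]
  obtain s t where B: "B \<in> Obj S"
    and fg: "f \<in> hom (fiber S E B) a b" "g \<in> hom (fiber S E B) a b"
    and q: "q \<in> hom (fiber S E B) b c" "q \<cdot>\<^bsub>E\<^esub> f = q \<cdot>\<^bsub>E\<^esub> g"
    and st: "s \<in> hom (fiber S E B) c b" "t \<in> hom (fiber S E B) b a"
    and eqs: "q \<cdot>\<^bsub>E\<^esub> s = Ident E c" "f \<cdot>\<^bsub>E\<^esub> t = Ident E b" "g \<cdot>\<^bsub>E\<^esub> t = s \<cdot>\<^bsub>E\<^esub> q"
    using fork by (auto simp: split_fork_def parallel_pair_def)
  have b: "omap (arity E) b = B" by (rule vertical_over(2)[OF E B fg(1)])
  have arr: "f \<in> Arr E" "g \<in> Arr E" "q \<in> Arr E" "s \<in> Arr E" "t \<in> Arr E"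
    and ends: "Dom E f = a" "Cod E f = b" "Dom E g = a" "Cod E g = b" "Dom E q = b" "Cod E q = c"
      "Dom E s = c" "Cod E s = b" "Dom E t = b" "Cod E t = a"
    and s_over: "amap (arity E) s = Ident S B"
    using fg q st by (auto simp: hom_def fiber_def)
  have "\<exists>!k. k \<in> hom E c y \<and> amap (arity E) k = amap (arity E) q' \<and> k \<cdot>\<^bsub>E\<^esub> q = q'"
    if q': "q' \<in> hom E b y" "q' \<cdot>\<^bsub>E\<^esub> f = q' \<cdot>\<^bsub>E\<^esub> g" for y q'
  proof (rule ex1I[of _ "q' \<cdot>\<^bsub>E\<^esub> s"])
    have q'_arr: "q' \<in> Arr E" "Dom E q' = b" "Cod E q' = y"
      using q'(1) by (auto simp: hom_def)
    have "(q' \<cdot>\<^bsub>E\<^esub> s) \<cdot>\<^bsub>E\<^esub> q = q' \<cdot>\<^bsub>E\<^esub> (g \<cdot>\<^bsub>E\<^esub> t)"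
      using q'_arr arr ends eqs by (simp add: E.assoc)
    also have "\<dots> = (q' \<cdot>\<^bsub>E\<^esub> f) \<cdot>\<^bsub>E\<^esub> t"
      using q'_arr arr ends by (simp only: q'(2)) (simp add: E.assoc)
    also have "\<dots> = q'"
      using q'_arr arr ends eqs by (simp add: E.assoc E.ident_cancel)
    finally have "(q' \<cdot>\<^bsub>E\<^esub> s) \<cdot>\<^bsub>E\<^esub> q = q'" .
    moreover have "amap (arity E) (q' \<cdot>\<^bsub>E\<^esub> s) = amap (arity E) q'"
      using q'_arr arr ends b s_over by (simp add: ar S.ident_cancel)
    ultimately show "q' \<cdot>\<^bsub>E\<^esub> s \<in> hom E c y \<and> amap (arity E) (q' \<cdot>\<^bsub>E\<^esub> s) = amap (arity E) q' \<and>
        (q' \<cdot>\<^bsub>E\<^esub> s) \<cdot>\<^bsub>E\<^esub> q = q'"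
      using q'_arr arr ends by (simp add: hom_def E.comp_arr)
  next
    fix k assume k: "k \<in> hom E c y \<and> amap (arity E) k = amap (arity E) q' \<and> k \<cdot>\<^bsub>E\<^esub> q = q'"
    have "q' \<cdot>\<^bsub>E\<^esub> s = (k \<cdot>\<^bsub>E\<^esub> q) \<cdot>\<^bsub>E\<^esub> s" using k by simp
    also have "\<dots> = k"
      using k arr ends eqs E.assoc[of s q k] by (simp add: hom_def E.ident_cancel)
    finally show "k = q' \<cdot>\<^bsub>E\<^esub> s" by simp
  qed
  then show ?thesis
    using B fg q by (auto simp: surcoequalizer_def parallel_pair_def)
qed

lemma surfunctor_split_fork:
  assumes E: "surcategory S E" and H: "surfunctor S E D H" and fork: "split_fork S E B a b f g c q"
  shows "split_fork S D B (omap H a) (omap H b) (amap H f) (amap H g) (omap H c) (amap H q)"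
proof -
  interpret E: category E by (rule surcategory_simps[OF E])
  note H_simps = is_functor_simps[OF surfunctor_simps(1)[OF H]]
  obtain s t where B: "B \<in> Obj S"
    and fg: "f \<in> hom (fiber S E B) a b" "g \<in> hom (fiber S E B) a b"
    and q: "q \<in> hom (fiber S E B) b c" "q \<cdot>\<^bsub>E\<^esub> f = q \<cdot>\<^bsub>E\<^esub> g"
    and st: "s \<in> hom (fiber S E B) c b" "t \<in> hom (fiber S E B) b a"
    and eqs: "q \<cdot>\<^bsub>E\<^esub> s = Ident E c" "f \<cdot>\<^bsub>E\<^esub> t = Ident E b" "g \<cdot>\<^bsub>E\<^esub> t = s \<cdot>\<^bsub>E\<^esub> q"
    using fork by (auto simp: split_fork_def parallel_pair_def)
  have H_comp: "amap H v \<cdot>\<^bsub>D\<^esub> amap H u = amap H (v \<cdot>\<^bsub>E\<^esub> u)"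
    if "u \<in> hom (fiber S E B) x y" "v \<in> hom (fiber S E B) y z" for u v x y z
    using that H_simps(6)[of u v] by (auto simp: hom_def fiber_def)
  have obj: "b \<in> Obj E" "c \<in> Obj E"
    using q(1) E.dom_closed E.cod_closed by (auto simp: hom_def fiber_def)
  show ?thesis
    unfolding split_fork_def parallel_pair_def
    using B fg q st eqs obj surfunctor_fiber[OF H]
    by (intro conjI bexI[of _ "amap H s"] bexI[of _ "amap H t"])
      (simp_all add: H_comp[OF fg(1) q(1)] H_comp[OF fg(2) q(1)] H_comp[OF st(1) q(1)]
        H_comp[OF st(2) fg(1)] H_comp[OF st(2) fg(2)] H_comp[OF q(1) st(1)] H_simps(5))
qed

lemma split_surcoequalizer_iff_split_fork:
  assumes "surcategory S E"
  shows "split_surcoequalizer S E B a b f g c q \<longleftrightarrow> split_fork S E B a b f g c q"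
proof
  show "split_fork S E B a b f g c q" if "split_surcoequalizer S E B a b f g c q"
    using that unfolding split_surcoequalizer_def split_fork_def surcoequalizer_def by blast
  show "split_surcoequalizer S E B a b f g c q" if fork: "split_fork S E B a b f g c q"
    using split_fork_surcoequalizer[OF assms fork] fork
    unfolding split_surcoequalizer_def split_fork_def by blast
qed

lemma split_absolute:
  fixes E :: "('o, 'a, 'b, 'h) surcat"
  assumes E: "surcategory S E" and split: "split_surcoequalizer S E B a b f g c q"
  shows "absolute_surcoequalizer S E B a b f g c q"
  unfolding absolute_surcoequalizer_def
proof (intro conjI allI impI)
  have fork: "split_fork S E B a b f g c q"
    using split by (simp add: split_surcoequalizer_iff_split_fork[OF E])
  show "surcoequalizer S E B a b f g c q"
    by (rule split_fork_surcoequalizer[OF E fork])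
  fix D :: "('o option, ('a + nat) list, 'b, 'h) surcat" and H
  assume D: "surcategory S D \<and> surfunctor S E D H"
  then have "split_fork S D B (omap H a) (omap H b) (amap H f) (amap H g) (omap H c) (amap H q)"
    using surfunctor_split_fork[OF E _ fork] by blast
  then show "surcoequalizer S D B (omap H a) (omap H b) (amap H f) (amap H g) (omap H c) (amap H q)"
    by (rule split_fork_surcoequalizer[OF conjunct1[OF D]])
qed

text \<open>Creation for a larger class of surcoequalizers in the target is the stronger condition.\<close>

lemma creates_mono:
  assumes "creates_surcoequalizers S A G P"
    and "\<And>B a b f g c q. Q B a b f g c q \<Longrightarrow> P B a b f g c q"
  shows "creates_surcoequalizers S A G Q"
  unfolding creates_surcoequalizers_def
proof (intro allI impI)
  fix B a b f g z e
  assume "parallel_pair S A B a b f g \<and> Q B (omap G a) (omap G b) (amap G f) (amap G g) z e"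
  then show "\<exists>c q. q \<in> hom A b c \<and> omap G c = z \<and> amap G q = e \<and>
      (\<forall>c' q'. q' \<in> hom A b c' \<and> omap G c' = z \<and> amap G q' = e \<longrightarrow> c' = c \<and> q' = q) \<and>
      surcoequalizer S A B a b f g c q"
    using assms(2) assms(1)[unfolded creates_surcoequalizers_def, rule_format, of B a b f g z e]
    by simp
qed

text \<open>Both arrows are solutions of the factorization problem for \<open>u q\<close>. The arity hypothesis is
  essential, because the universal property speaks only of factorizations over the arity of \<open>u q\<close>,
  which is that of \<open>u\<close>.\<close>

lemma surcoequalizer_cancel:
  assumes E: "surcategory S E" and q: "surcoequalizer S E B a b f g c q"
    and uv: "u \<in> hom E c y" "v \<in> hom E c y" "amap (arity E) u = amap (arity E) v"
    and eq: "u \<cdot>\<^bsub>E\<^esub> q = v \<cdot>\<^bsub>E\<^esub> q"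
  shows "u = v"
proof -
  interpret S: category S by (rule surcategory_simps[OF E])
  interpret E: category E by (rule surcategory_simps[OF E])
  note ar = is_functor_simps[OF surcategory_simps(3)[OF E]]
  have B: "B \<in> Obj S" and q_fib: "q \<in> hom (fiber S E B) b c"
    and arr: "f \<in> Arr E" "g \<in> Arr E" "q \<in> Arr E"
    and ends: "Cod E f = b" "Cod E g = b" "Dom E q = b" "Cod E q = c"
    and q_over: "amap (arity E) q = Ident S B" and fork: "q \<cdot>\<^bsub>E\<^esub> f = q \<cdot>\<^bsub>E\<^esub> g"
    using q unfolding surcoequalizer_def parallel_pair_def by (simp_all add: hom_def fiber_def)
  have univ: "\<exists>!k. k \<in> hom E c y \<and> amap (arity E) k = amap (arity E) q' \<and> k \<cdot>\<^bsub>E\<^esub> q = q'"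
    if "q' \<in> hom E b y" "q' \<cdot>\<^bsub>E\<^esub> f = q' \<cdot>\<^bsub>E\<^esub> g" for q'
    using q that unfolding surcoequalizer_def by blast
  have c: "omap (arity E) c = B" by (rule vertical_over(2)[OF E B q_fib])
  have u: "u \<in> Arr E" "Dom E u = c" "Cod E u = y" using uv(1) by (auto simp: hom_def)
  have "(u \<cdot>\<^bsub>E\<^esub> q) \<cdot>\<^bsub>E\<^esub> f = (u \<cdot>\<^bsub>E\<^esub> q) \<cdot>\<^bsub>E\<^esub> g"
    using u arr ends fork by (simp add: E.assoc)
  moreover have "u \<cdot>\<^bsub>E\<^esub> q \<in> hom E b y"
    using u arr ends by (simp add: hom_def E.comp_arr)
  moreover have "amap (arity E) (u \<cdot>\<^bsub>E\<^esub> q) = amap (arity E) u"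
    using u arr ends q_over c by (simp add: ar S.ident_cancel)
  ultimately show ?thesis
    using univ[of "u \<cdot>\<^bsub>E\<^esub> q"] uv eq by metis
qed


section \<open>The comparison surfunctor\<close>

locale comparison_situation =
  fixes S :: "('b, 'h) cat"
    and A :: "('o, 'a, 'b, 'h) surcat" and X :: "('p, 'c, 'b, 'h) surcat"
    and F :: "('p, 'c, 'o, 'a) func" and G :: "('o, 'a, 'p, 'c) func"
    and \<eta> :: "'p \<Rightarrow> 'c" and \<epsilon> :: "'o \<Rightarrow> 'a"
    and K :: "('o, 'a, 'p \<times> 'c, ('p \<times> 'c) \<times> 'c \<times> ('p \<times> 'c)) func"
  assumes A: "surcategory S A" and X: "surcategory S X"
    and adj: "suradjunction S A X F G \<eta> \<epsilon>"
    and comparison: "comparison S A X F G (induced_monad F G \<eta> \<epsilon>) K"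
begin

abbreviation "T \<equiv> induced_monad F G \<eta> \<epsilon>"

abbreviation comp_A (infixl "\<circ>\<^sub>A" 70) where "v \<circ>\<^sub>A u \<equiv> v \<cdot>\<^bsub>A\<^esub> u"
abbreviation comp_X (infixl "\<circ>\<^sub>X" 70) where "v \<circ>\<^sub>X u \<equiv> v \<cdot>\<^bsub>X\<^esub> u"

sublocale S: category S by (rule surcategory_simps(1)[OF A])
sublocale A: category A by (rule surcategory_simps(2)[OF A])
sublocale X: category X by (rule surcategory_simps(2)[OF X])

lemma surfunctor_F: "surfunctor S X A F" and surfunctor_G: "surfunctor S A X G"
  and surfunctor_K: "surfunctor S A (EM X T) K"
  using adj comparison by (auto simp: suradjunction_def comparison_def)

lemmas F_simps = is_functor_simps[OF surfunctor_simps(1)[OF surfunctor_F]]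
  surfunctor_simps(2,3)[OF surfunctor_F]
lemmas G_simps = is_functor_simps[OF surfunctor_simps(1)[OF surfunctor_G]]
  surfunctor_simps(2,3)[OF surfunctor_G]
lemmas K_simps = is_functor_simps[OF surfunctor_simps(1)[OF surfunctor_K]]
lemmas arity_A = is_functor_simps[OF surcategory_simps(3)[OF A]]
lemmas arity_X = is_functor_simps[OF surcategory_simps(3)[OF X]]

lemma unit_simps:
  assumes "x \<in> Obj X"
  shows "\<eta> x \<in> Arr X" "Dom X (\<eta> x) = x" "Cod X (\<eta> x) = omap G (omap F x)"
    "amap (arity X) (\<eta> x) = Ident S (omap (arity X) x)"
  using adj assms by (auto simp: suradjunction_def surnat_def fcomp_def fid_def hom_def)

lemma counit_simps:
  assumes "a \<in> Obj A"
  shows "\<epsilon> a \<in> Arr A" "Dom A (\<epsilon> a) = omap F (omap G a)" "Cod A (\<epsilon> a) = a"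
    "amap (arity A) (\<epsilon> a) = Ident S (omap (arity A) a)"
  using adj assms by (auto simp: suradjunction_def surnat_def fcomp_def fid_def hom_def)

lemma unit_natural:
  "u \<in> Arr X \<Longrightarrow> amap G (amap F u) \<circ>\<^sub>X \<eta> (Dom X u) = \<eta> (Cod X u) \<circ>\<^sub>X u"
  using adj by (simp add: suradjunction_def surnat_def fcomp_def fid_def)

lemma counit_natural:
  "u \<in> Arr A \<Longrightarrow> \<epsilon> (Cod A u) \<circ>\<^sub>A amap F (amap G u) = u \<circ>\<^sub>A \<epsilon> (Dom A u)"
  using adj by (simp add: suradjunction_def surnat_def fcomp_def fid_def)

lemma triangle_F: "x \<in> Obj X \<Longrightarrow> \<epsilon> (omap F x) \<circ>\<^sub>A amap F (\<eta> x) = Ident A (omap F x)"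
  and triangle_G: "a \<in> Obj A \<Longrightarrow> amap G (\<epsilon> a) \<circ>\<^sub>X \<eta> (omap G a) = Ident X (omap G a)"
  using adj by (auto simp: suradjunction_def)

lemmas [simp] = A.category_simps X.category_simps S.ident_cancel S.ident_arr F_simps G_simps
  unit_simps counit_simps triangle_F triangle_G arity_A arity_X

lemma G_counit_natural:
  "u \<in> Arr A \<Longrightarrow>
    amap G (\<epsilon> (Cod A u)) \<circ>\<^sub>X amap G (amap F (amap G u)) = amap G u \<circ>\<^sub>X amap G (\<epsilon> (Dom A u))"
  using arg_cong[OF counit_natural[of u], of "amap G"] by simp

lemma mult_unit: "x \<in> Obj X \<Longrightarrow>
    amap G (\<epsilon> (omap F x)) \<circ>\<^sub>X amap G (amap F (\<eta> x)) = Ident X (omap G (omap F x))"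
  using arg_cong[OF triangle_F[of x], of "amap G"] by (simp del: triangle_F)

lemma algebra_iff:
  "(x, h) \<in> algebras X T \<longleftrightarrow>
     x \<in> Obj X \<and> h \<in> Arr X \<and> Dom X h = omap G (omap F x) \<and> Cod X h = x \<and>
     h \<circ>\<^sub>X \<eta> x = Ident X x \<and> h \<circ>\<^sub>X amap G (amap F h) = h \<circ>\<^sub>X amap G (\<epsilon> (omap F x))"
  by (auto simp: algebras_def induced_monad_def fcomp_def hom_def)

lemma EM_arr_iff:
  "((x, h), u, (y, k)) \<in> Arr (EM X T) \<longleftrightarrow>
     (x, h) \<in> algebras X T \<and> (y, k) \<in> algebras X T \<and> u \<in> Arr X \<and> Dom X u = x \<and> Cod X u = y \<and>
     u \<circ>\<^sub>X h = k \<circ>\<^sub>X amap G (amap F u)"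
  by (auto simp: EM_def induced_monad_def fcomp_def hom_def)

text \<open>The unit law gives this, since the unit is vertical. It makes the cancellation lemma for
  surcoequalizers applicable to structure arrows.\<close>

lemma algebra_over:
  assumes "(x, h) \<in> algebras X T"
  shows "amap (arity X) h = Ident S (omap (arity X) x)"
proof -
  have h: "x \<in> Obj X" "h \<in> Arr X" "Dom X h = omap G (omap F x)" "Cod X h = x"
    and "h \<circ>\<^sub>X \<eta> x = Ident X x"
    using assms by (simp_all add: algebra_iff)
  then have "amap (arity X) (h \<circ>\<^sub>X \<eta> x) = Ident S (omap (arity X) x)" by simp
  then show ?thesis using h by (simp del: \<open>h \<circ>\<^sub>X \<eta> x = Ident X x\<close>)
qed

lemma K_arr_shape:
  assumes "u \<in> Arr A"
  shows "amap K u = (omap K (Dom A u), amap G u, omap K (Cod A u))"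
proof -
  obtain p v r where v: "amap K u = (p, v, r)" by (cases "amap K u")
  have "v = amap G u"
    using comparison assms v by (auto simp: comparison_def functor_eq_def fcomp_def forget_EM_def)
  moreover have "p = omap K (Dom A u)" "r = omap K (Cod A u)"
    using K_simps(3,4)[OF assms] v by (auto simp: EM_def)
  ultimately show ?thesis using v by simp
qed

text \<open>The structure \<open>h\<close> of \<open>K a\<close> is forced: \<open>\<epsilon>\<^sub>a : FGa \<rightarrow> a\<close> is sent to a homomorphism from the free
  algebra on \<open>G a\<close>, hence \<open>G \<epsilon>\<^sub>a \<circ> \<mu> = h \<circ> GFG \<epsilon>\<^sub>a\<close>, and composing with \<open>GF \<eta>\<close> leaves
  \<open>G \<epsilon>\<^sub>a = h\<close>.\<close>

lemma K_obj:
  assumes a: "a \<in> Obj A"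
  shows "omap K a = (omap G a, amap G (\<epsilon> a))"
proof -
  obtain x h where xh: "omap K a = (x, h)" by (cases "omap K a")
  have x: "x = omap G a"
    using comparison a xh by (auto simp: comparison_def functor_eq_def fcomp_def forget_EM_def)
  have alg: "(x, h) \<in> algebras X T"
    using K_simps(1)[OF a] xh by (simp add: EM_def)
  have "omap K (omap F x) = (omap G (omap F x), amap G (\<epsilon> (omap F x)))"
    using comparison a x
    by (auto simp: comparison_def functor_eq_def fcomp_def free_EM_def induced_monad_def)
  then have "((omap G (omap F x), amap G (\<epsilon> (omap F x))), amap G (\<epsilon> a), (x, h)) \<in> Arr (EM X T)"
    using K_simps(2)[of "\<epsilon> a"] K_arr_shape[of "\<epsilon> a"] a xh x by simp
  then have hom: "amap G (\<epsilon> a) \<circ>\<^sub>X amap G (\<epsilon> (omap F x)) = h \<circ>\<^sub>X amap G (amap F (amap G (\<epsilon> a)))"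
    by (simp add: EM_arr_iff)
  have h: "h \<in> Arr X" "Dom X h = omap G (omap F x)" using alg by (simp_all add: algebra_iff)
  have "amap G (\<epsilon> a) =
      (amap G (\<epsilon> a) \<circ>\<^sub>X amap G (\<epsilon> (omap F x))) \<circ>\<^sub>X amap G (amap F (\<eta> x))"
    using a x by (simp add: mult_unit)
  also have "\<dots> = h \<circ>\<^sub>X (amap G (amap F (amap G (\<epsilon> a))) \<circ>\<^sub>X amap G (amap F (\<eta> x)))"
    unfolding hom using a x h by simp
  also have "amap G (amap F (amap G (\<epsilon> a))) \<circ>\<^sub>X amap G (amap F (\<eta> x)) =
      amap G (amap F (amap G (\<epsilon> a) \<circ>\<^sub>X \<eta> x))"
    using a x by (simp del: triangle_G)
  also have "h \<circ>\<^sub>X \<dots> = h"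
    using a x h by simp
  finally show ?thesis using xh x by simp
qed

lemma K_arr:
  assumes "u \<in> Arr A"
  shows "amap K u = ((omap G (Dom A u), amap G (\<epsilon> (Dom A u))), amap G u,
    (omap G (Cod A u), amap G (\<epsilon> (Cod A u))))"
  using assms by (simp add: K_arr_shape K_obj)

lemma counit_algebra: "a \<in> Obj A \<Longrightarrow> (omap G a, amap G (\<epsilon> a)) \<in> algebras X T"
  using K_simps(1)[of a] by (simp add: K_obj EM_def)

lemma K_iso_iff:
  "sur_isomorphism S A (EM X T) K \<longleftrightarrow>
    bij_betw (omap K) (Obj A) (algebras X T) \<and> bij_betw (amap K) (Arr A) (Arr (EM X T))"
proof -
  have "surcategory S (EM X T)"
    by (rule surcategory_EM[OF X induced_surmonad[OF A X adj]])
  then show ?thesis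
    using sur_isomorphism_iff_bij[OF A _ surfunctor_K] by (simp add: EM_def)
qed


section \<open>Creation for split forks makes the comparison an isomorphism\<close>

text \<open>The splittings are \<open>\<eta>\<close> at \<open>x\<close> and at \<open>GFx\<close>. The splitting equations are the unit law of the
  algebra, a triangle identity and the naturality of \<open>\<eta>\<close> at \<open>h\<close>.\<close>

lemma canonical_split_fork:
  assumes alg: "(x, h) \<in> algebras X T"
  shows "split_fork S X (omap (arity X) x) (omap G (omap F (omap G (omap F x)))) (omap G (omap F x))
    (amap G (\<epsilon> (omap F x))) (amap G (amap F h)) x h"
proof -
  have h: "x \<in> Obj X" "h \<in> Arr X" "Dom X h = omap G (omap F x)" "Cod X h = x"
    and h_over: "amap (arity X) h = Ident S (omap (arity X) x)"
    and "h \<circ>\<^sub>X \<eta> x = Ident X x" "h \<circ>\<^sub>X amap G (amap F h) = h \<circ>\<^sub>X amap G (\<epsilon> (omap F x))"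
    using alg algebra_over[OF alg] by (simp_all add: algebra_iff)
  then show ?thesis
    unfolding split_fork_def parallel_pair_def
    using unit_natural[OF h(2)]
    by (intro conjI bexI[of _ "\<eta> x"] bexI[of _ "\<eta> (omap G (omap F x))"])
      (simp_all add: hom_def fiber_def)
qed

text \<open>The arrow \<open>q : Fx \<rightarrow> c\<close> created from the canonical fork has \<open>G q = h\<close>. Naturality of the counit
  at \<open>q\<close>, composed with \<open>GF \<eta>\<close>, gives \<open>G \<epsilon>\<^sub>c = h\<close>. Hence \<open>\<epsilon>\<^sub>c\<close> is another lift of \<open>h\<close>, and the
  uniqueness of lifts makes it equal to \<open>q\<close>. The same uniqueness applied to the counit at \<open>c'\<close> shows
  that \<open>c\<close> is determined by its algebra.\<close>

lemma lift_algebra: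
  assumes creates: "creates_surcoequalizers S A G (split_surcoequalizer S X)"
    and alg: "(x, h) \<in> algebras X T"
  obtains c where "c \<in> Obj A" "omap G c = x" "amap G (\<epsilon> c) = h"
    "surcoequalizer S A (omap (arity X) x) (omap F (omap G (omap F x))) (omap F x)
       (\<epsilon> (omap F x)) (amap F h) c (\<epsilon> c)"
    "\<And>c'. c' \<in> Obj A \<Longrightarrow> omap G c' = x \<Longrightarrow> amap G (\<epsilon> c') = h \<Longrightarrow> c' = c"
proof -
  let ?B = "omap (arity X) x"
  have h: "x \<in> Obj X" "h \<in> Arr X" "Dom X h = omap G (omap F x)" "Cod X h = x"
    "amap (arity X) h = Ident S ?B" "h \<circ>\<^sub>X \<eta> x = Ident X x"
    using alg algebra_over[OF alg] by (simp_all add: algebra_iff)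
  have "parallel_pair S A ?B (omap F (omap G (omap F x))) (omap F x) (\<epsilon> (omap F x)) (amap F h)"
    using h by (simp add: parallel_pair_def hom_def fiber_def)
  moreover have "split_surcoequalizer S X ?B (omap G (omap F (omap G (omap F x)))) (omap G (omap F x))
      (amap G (\<epsilon> (omap F x))) (amap G (amap F h)) x h"
    using canonical_split_fork[OF alg] split_surcoequalizer_iff_split_fork[OF X] by blast
  ultimately obtain c q where q: "q \<in> hom A (omap F x) c" "omap G c = x" "amap G q = h"
    and unique: "\<And>c' q'. q' \<in> hom A (omap F x) c' \<Longrightarrow> omap G c' = x \<Longrightarrow> amap G q' = h \<Longrightarrow>
      c' = c \<and> q' = q"
    and coeq: "surcoequalizer S A ?B (omap F (omap G (omap F x))) (omap F x)
      (\<epsilon> (omap F x)) (amap F h) c q"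
    using creates[unfolded creates_surcoequalizers_def, rule_format, of ?B "omap F (omap G (omap F x))"
        "omap F x" "\<epsilon> (omap F x)" "amap F h" x h]
    by blast
  have q_arr: "q \<in> Arr A" "Dom A q = omap F x" "Cod A q = c" and c: "c \<in> Obj A"
    using q(1) A.cod_closed by (auto simp: hom_def)
  have "h = (h \<circ>\<^sub>X amap G (\<epsilon> (omap F x))) \<circ>\<^sub>X amap G (amap F (\<eta> x))"
    using h by (simp add: mult_unit)
  also have "h \<circ>\<^sub>X amap G (\<epsilon> (omap F x)) = amap G (\<epsilon> c) \<circ>\<^sub>X amap G (amap F h)"
    using G_counit_natural[OF q_arr(1)] q_arr q by simp
  also have "(amap G (\<epsilon> c) \<circ>\<^sub>X amap G (amap F h)) \<circ>\<^sub>X amap G (amap F (\<eta> x)) =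
      amap G (\<epsilon> c) \<circ>\<^sub>X amap G (amap F (h \<circ>\<^sub>X \<eta> x))"
    using h(1-4) c q(2) by simp
  also have "\<dots> = amap G (\<epsilon> c)"
    using h c q(2) by simp
  finally have counit: "amap G (\<epsilon> c) = h" by simp
  have "\<epsilon> c = q"
    using unique[of "\<epsilon> c" c] c q(2) counit by (simp add: hom_def)
  moreover have "c' = c" if "c' \<in> Obj A" "omap G c' = x" "amap G (\<epsilon> c') = h" for c'
    using unique[of "\<epsilon> c'" c'] that by (simp add: hom_def)
  ultimately show ?thesis
    using that c q(2) counit coeq by blast
qed

text \<open>Lifting the algebra of \<open>a\<close> gives back \<open>a\<close>, so every object is the surcoequalizer of its canonical
  presentation by free objects.\<close>

lemma counit_surcoequalizer:
  assumes creates: "creates_surcoequalizers S A G (split_surcoequalizer S X)"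
    and a: "a \<in> Obj A"
  shows "surcoequalizer S A (omap (arity A) a) (omap F (omap G (omap F (omap G a))))
    (omap F (omap G a)) (\<epsilon> (omap F (omap G a))) (amap F (amap G (\<epsilon> a))) a (\<epsilon> a)"
proof -
  obtain c where "surcoequalizer S A (omap (arity X) (omap G a))
      (omap F (omap G (omap F (omap G a)))) (omap F (omap G a))
      (\<epsilon> (omap F (omap G a))) (amap F (amap G (\<epsilon> a))) c (\<epsilon> c)" "a = c"
    using lift_algebra[OF creates counit_algebra[OF a]] a by metis
  then show ?thesis using a by simp
qed

text \<open>By naturality \<open>k \<epsilon>\<^sub>a = \<epsilon>\<^sub>b \<circ> FG k\<close> depends only on \<open>G k\<close>, and so does the arity of \<open>k\<close>.\<close>

lemma split_creation_faithful:
  assumes creates: "creates_surcoequalizers S A G (split_surcoequalizer S X)"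
    and k: "k \<in> hom A a b" and l: "l \<in> hom A a b" and eq: "amap G k = amap G l"
  shows "k = l"
proof (rule surcoequalizer_cancel[OF A])
  have kl: "k \<in> Arr A" "Dom A k = a" "Cod A k = b" "l \<in> Arr A" "Dom A l = a" "Cod A l = b"
    using k l by (auto simp: hom_def)
  then show "surcoequalizer S A (omap (arity A) a) (omap F (omap G (omap F (omap G a))))
    (omap F (omap G a)) (\<epsilon> (omap F (omap G a))) (amap F (amap G (\<epsilon> a))) a (\<epsilon> a)"
    using counit_surcoequalizer[OF creates] by auto
  show "amap (arity A) k = amap (arity A) l"
    using arg_cong[OF eq, of "amap (arity X)"] kl by simp
  show "k \<circ>\<^sub>A \<epsilon> a = l \<circ>\<^sub>A \<epsilon> a"
    using counit_natural[OF kl(1)] counit_natural[OF kl(4)] kl eq by simp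
qed (use k l in auto)

text \<open>The homomorphism equation for \<open>u\<close> says that \<open>\<epsilon>\<^sub>b \<circ> Fu\<close> equalizes the canonical pair of \<open>a\<close>.
  The induced \<open>k : a \<rightarrow> b\<close> satisfies \<open>G k \<circ> G \<epsilon>\<^sub>a = u \<circ> G \<epsilon>\<^sub>a\<close>, and \<open>G \<epsilon>\<^sub>a\<close> is split
  epic.\<close>

lemma split_creation_full:
  assumes creates: "creates_surcoequalizers S A G (split_surcoequalizer S X)"
    and a: "a \<in> Obj A" and b: "b \<in> Obj A"
    and u: "((omap G a, amap G (\<epsilon> a)), u, (omap G b, amap G (\<epsilon> b))) \<in> Arr (EM X T)"
  obtains k where "k \<in> hom A a b" "amap G k = u"
proof -
  have u_arr: "u \<in> Arr X" "Dom X u = omap G a" "Cod X u = omap G b"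
    and u_hom: "u \<circ>\<^sub>X amap G (\<epsilon> a) = amap G (\<epsilon> b) \<circ>\<^sub>X amap G (amap F u)"
    using u by (simp_all add: EM_arr_iff)
  let ?q = "\<epsilon> b \<circ>\<^sub>A amap F u"
  have "?q \<circ>\<^sub>A amap F (amap G (\<epsilon> a)) = \<epsilon> b \<circ>\<^sub>A amap F (u \<circ>\<^sub>X amap G (\<epsilon> a))"
    using a b u_arr by simp
  also have "\<dots> = (\<epsilon> b \<circ>\<^sub>A amap F (amap G (\<epsilon> b))) \<circ>\<^sub>A amap F (amap G (amap F u))"
    unfolding u_hom using a b u_arr by simp
  also have "\<epsilon> b \<circ>\<^sub>A amap F (amap G (\<epsilon> b)) = \<epsilon> b \<circ>\<^sub>A \<epsilon> (omap F (omap G b))"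
    using counit_natural[of "\<epsilon> b"] b by simp
  also have "(\<epsilon> b \<circ>\<^sub>A \<epsilon> (omap F (omap G b))) \<circ>\<^sub>A amap F (amap G (amap F u)) =
      ?q \<circ>\<^sub>A \<epsilon> (omap F (omap G a))"
    using counit_natural[of "amap F u"] a b u_arr by simp
  finally have "?q \<circ>\<^sub>A \<epsilon> (omap F (omap G a)) = ?q \<circ>\<^sub>A amap F (amap G (\<epsilon> a))" by simp
  moreover have "?q \<in> hom A (omap F (omap G a)) b"
    using a b u_arr by (simp add: hom_def)
  ultimately obtain k where k: "k \<in> hom A a b" "k \<circ>\<^sub>A \<epsilon> a = ?q"
    using counit_surcoequalizer[OF creates a] unfolding surcoequalizer_def by blast
  have k_arr: "k \<in> Arr A" "Dom A k = a" "Cod A k = b"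
    using k(1) by (auto simp: hom_def)
  have "amap G k = amap G (k \<circ>\<^sub>A \<epsilon> a) \<circ>\<^sub>X \<eta> (omap G a)"
    using k_arr a by simp
  also have "\<dots> = (amap G (\<epsilon> b) \<circ>\<^sub>X amap G (amap F u)) \<circ>\<^sub>X \<eta> (omap G a)"
    unfolding k(2) using a b u_arr by simp
  also have "\<dots> = (u \<circ>\<^sub>X amap G (\<epsilon> a)) \<circ>\<^sub>X \<eta> (omap G a)"
    by (simp only: u_hom)
  also have "\<dots> = u"
    using a u_arr by simp
  finally show ?thesis using that k(1) by blast
qed

lemma split_creation_imp_iso:
  assumes creates: "creates_surcoequalizers S A G (split_surcoequalizer S X)"
  shows "sur_isomorphism S A (EM X T) K"
  unfolding K_iso_iff
proof
  have lift: "\<exists>c \<in> Obj A. omap G c = x \<and> amap G (\<epsilon> c) = h"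
    and lift_unique: "\<And>c c'. \<lbrakk>c \<in> Obj A; omap G c = x; amap G (\<epsilon> c) = h;
      c' \<in> Obj A; omap G c' = x; amap G (\<epsilon> c') = h\<rbrakk> \<Longrightarrow> c = c'"
    if "(x, h) \<in> algebras X T" for x h
    using lift_algebra[OF creates that] by metis+
  have K_eq: "a = b" if "a \<in> Obj A" "b \<in> Obj A" "omap K a = omap K b" for a b
    using lift_unique[OF counit_algebra[of b], of a b] that by (simp add: K_obj)
  show "bij_betw (omap K) (Obj A) (algebras X T)"
    unfolding bij_betw_def
  proof (intro conjI inj_onI K_eq)
    show "omap K ` Obj A = algebras X T"
      using lift counit_algebra by (auto simp: K_obj image_iff)
  qed
  show "bij_betw (amap K) (Arr A) (Arr (EM X T))"
    unfolding bij_betw_def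
  proof (intro conjI inj_onI subset_antisym subsetI)
    fix k l assume kl: "k \<in> Arr A" "l \<in> Arr A" "amap K k = amap K l"
    then have "Dom A k = Dom A l" "Cod A k = Cod A l"
      by (auto intro!: K_eq simp: K_arr_shape)
    moreover have "amap G k = amap G l"
      using kl by (simp add: K_arr)
    ultimately show "k = l"
      using kl split_creation_faithful[OF creates, of k "Dom A k" "Cod A k" l] by (simp add: hom_def)
  next
    fix w assume "w \<in> amap K ` Arr A"
    then show "w \<in> Arr (EM X T)" using K_simps(2) by auto
  next
    fix w assume w: "w \<in> Arr (EM X T)"
    obtain x h u y k where w_eq: "w = ((x, h), u, (y, k))" by (cases w) auto
    obtain a b where "a \<in> Obj A" "omap G a = x" "amap G (\<epsilon> a) = h"
      "b \<in> Obj A" "omap G b = y" "amap G (\<epsilon> b) = k"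
      using w w_eq lift by (metis EM_arr_iff)
    moreover from this obtain v where "v \<in> hom A a b" "amap G v = u"
      using w w_eq split_creation_full[OF creates, of a b u] by auto
    ultimately show "w \<in> amap K ` Arr A"
      using w_eq by (intro image_eqI[of _ _ v]) (auto simp: K_arr hom_def)
  qed
qed


section \<open>An isomorphic comparison gives creation for absolute surcoequalizers\<close>

text \<open>The forgetful functor from algebras creates absolute surcoequalizers. The structure \<open>h\<close> comes
  from the universal property of \<open>GFe\<close>, as the unique solution of \<open>h \<circ> GFe = e \<circ> G \<epsilon>\<^sub>b\<close>. Its unit law
  is checked by cancelling \<open>e\<close>, its associativity by cancelling \<open>GFGFe\<close>. The last conclusion
  transfers the universal property of \<open>e\<close> from \<open>X\<close> to algebras: an arrow out of \<open>z\<close> is a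
  homomorphism as soon as its composite with \<open>e\<close> is one, because \<open>GFe\<close> can be
  cancelled.\<close>

lemma absolute_surcoequalizer_algebra:
  assumes pair: "parallel_pair S A B a b f g"
    and abs: "absolute_surcoequalizer S X B (omap G a) (omap G b) (amap G f) (amap G g) z e"
  obtains h where "((omap G b, amap G (\<epsilon> b)), e, (z, h)) \<in> Arr (EM X T)"
    and "\<And>k. (z, k) \<in> algebras X T \<Longrightarrow> e \<circ>\<^sub>X amap G (\<epsilon> b) = k \<circ>\<^sub>X amap G (amap F e) \<Longrightarrow> k = h"
    and "\<And>y k v. \<lbrakk>(y, k) \<in> algebras X T; v \<in> hom X z y;
      ((omap G b, amap G (\<epsilon> b)), v \<circ>\<^sub>X e, (y, k)) \<in> Arr (EM X T)\<rbrakk> \<Longrightarrow>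
      ((z, h), v, (y, k)) \<in> Arr (EM X T)"
proof -
  have fg: "f \<in> Arr A" "Dom A f = a" "Cod A f = b" "g \<in> Arr A" "Dom A g = a" "Cod A g = b"
    and fib: "f \<in> hom (fiber S A B) a b" and B: "B \<in> Obj S"
    using pair by (auto simp: parallel_pair_def hom_def fiber_def)
  have ab: "a \<in> Obj A" "b \<in> Obj A" "omap (arity A) b = B"
    using fg A.dom_closed A.cod_closed vertical_over(2)[OF A B fib] by auto
  have e_coeq: "surcoequalizer S X B (omap G a) (omap G b) (amap G f) (amap G g) z e"
    using abs by (simp add: absolute_surcoequalizer_def)
  have e: "e \<in> Arr X" "Dom X e = omap G b" "Cod X e = z" "amap (arity X) e = Ident S B"
    and e_fork: "e \<circ>\<^sub>X amap G f = e \<circ>\<^sub>X amap G g"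
    and e_fib: "e \<in> hom (fiber S X B) (omap G b) z"
    using e_coeq unfolding surcoequalizer_def by (simp_all add: hom_def fiber_def)
  have z: "z \<in> Obj X" "omap (arity X) z = B"
    using e X.cod_closed vertical_over(2)[OF X B e_fib] by auto
  note T_fun = surfunctor_fcomp[OF surfunctor_F surfunctor_G]
  have T_coeq: "surcoequalizer S X B (omap G (omap F (omap G a))) (omap G (omap F (omap G b)))
      (amap G (amap F (amap G f))) (amap G (amap F (amap G g))) (omap G (omap F z)) (amap G (amap F e))"
    using absolute_preserved[OF X X T_fun abs] by (simp add: fcomp_def)
  have TT_coeq: "surcoequalizer S X B
      (omap G (omap F (omap G (omap F (omap G a))))) (omap G (omap F (omap G (omap F (omap G b)))))
      (amap G (amap F (amap G (amap F (amap G f))))) (amap G (amap F (amap G (amap F (amap G g)))))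
      (omap G (omap F (omap G (omap F z)))) (amap G (amap F (amap G (amap F e))))"
    using absolute_preserved[OF X X surfunctor_fcomp[OF T_fun T_fun] abs] by (simp add: fcomp_def)
  let ?q = "e \<circ>\<^sub>X amap G (\<epsilon> b)"
  have "?q \<circ>\<^sub>X amap G (amap F (amap G f)) = (e \<circ>\<^sub>X amap G f) \<circ>\<^sub>X amap G (\<epsilon> a)"
    using G_counit_natural[OF fg(1)] fg ab e by simp
  also have "\<dots> = (e \<circ>\<^sub>X amap G g) \<circ>\<^sub>X amap G (\<epsilon> a)"
    by (simp only: e_fork)
  also have "\<dots> = ?q \<circ>\<^sub>X amap G (amap F (amap G g))"
    using G_counit_natural[OF fg(4)] fg ab e by simp
  finally have "?q \<circ>\<^sub>X amap G (amap F (amap G f)) = ?q \<circ>\<^sub>X amap G (amap F (amap G g))" .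
  moreover have "?q \<in> hom X (omap G (omap F (omap G b))) z"
    using ab e by (simp add: hom_def)
  ultimately obtain h where h_hom: "h \<in> hom X (omap G (omap F z)) z"
    and h_over: "amap (arity X) h = amap (arity X) ?q" and h_eq: "h \<circ>\<^sub>X amap G (amap F e) = ?q"
    using T_coeq unfolding surcoequalizer_def by blast
  have h: "h \<in> Arr X" "Dom X h = omap G (omap F z)" "Cod X h = z" "amap (arity X) h = Ident S B"
    using h_hom h_over ab e B by (auto simp: hom_def)
  have T_e: "amap G (amap F e) \<circ>\<^sub>X \<eta> (omap G b) = \<eta> z \<circ>\<^sub>X e"
    using unit_natural[OF e(1)] e by simp
  have h_unit: "h \<circ>\<^sub>X \<eta> z = Ident X z"
  proof (rule surcoequalizer_cancel[OF X e_coeq])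
    have "(h \<circ>\<^sub>X \<eta> z) \<circ>\<^sub>X e = (h \<circ>\<^sub>X amap G (amap F e)) \<circ>\<^sub>X \<eta> (omap G b)"
      using h e z ab T_e by simp
    also have "\<dots> = e"
      unfolding h_eq using e ab by simp
    finally show "(h \<circ>\<^sub>X \<eta> z) \<circ>\<^sub>X e = Ident X z \<circ>\<^sub>X e"
      using e z by simp
  qed (use h z B in \<open>auto simp: hom_def\<close>)
  have h_mult: "h \<circ>\<^sub>X amap G (amap F h) = h \<circ>\<^sub>X amap G (\<epsilon> (omap F z))"
  proof (rule surcoequalizer_cancel[OF X TT_coeq])
    have "(h \<circ>\<^sub>X amap G (amap F h)) \<circ>\<^sub>X amap G (amap F (amap G (amap F e))) =
        h \<circ>\<^sub>X amap G (amap F (h \<circ>\<^sub>X amap G (amap F e)))"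
      using h e z ab by simp
    also have "\<dots> = h \<circ>\<^sub>X amap G (amap F (e \<circ>\<^sub>X amap G (\<epsilon> b)))"
      by (simp only: h_eq)
    also have "\<dots> = (h \<circ>\<^sub>X amap G (amap F e)) \<circ>\<^sub>X amap G (amap F (amap G (\<epsilon> b)))"
      using h e z ab by simp
    also have "\<dots> = e \<circ>\<^sub>X (amap G (\<epsilon> b) \<circ>\<^sub>X amap G (amap F (amap G (\<epsilon> b))))"
      unfolding h_eq using e ab by simp
    also have "amap G (\<epsilon> b) \<circ>\<^sub>X amap G (amap F (amap G (\<epsilon> b))) =
        amap G (\<epsilon> b) \<circ>\<^sub>X amap G (\<epsilon> (omap F (omap G b)))"
      using G_counit_natural[of "\<epsilon> b"] ab by simp
    also have "e \<circ>\<^sub>X \<dots> = (h \<circ>\<^sub>X amap G (amap F e)) \<circ>\<^sub>X amap G (\<epsilon> (omap F (omap G b)))"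
      unfolding h_eq using e ab by simp
    also have "\<dots> = (h \<circ>\<^sub>X amap G (\<epsilon> (omap F z))) \<circ>\<^sub>X amap G (amap F (amap G (amap F e)))"
      using G_counit_natural[of "amap F e"] h e z ab by simp
    finally show "(h \<circ>\<^sub>X amap G (amap F h)) \<circ>\<^sub>X amap G (amap F (amap G (amap F e))) =
        (h \<circ>\<^sub>X amap G (\<epsilon> (omap F z))) \<circ>\<^sub>X amap G (amap F (amap G (amap F e)))" .
  qed (use h z B in \<open>auto simp: hom_def\<close>)
  have alg: "(z, h) \<in> algebras X T"
    using z h h_unit h_mult by (simp add: algebra_iff)
  show ?thesis
  proof (rule that)
    show "((omap G b, amap G (\<epsilon> b)), e, (z, h)) \<in> Arr (EM X T)"
      using alg counit_algebra[OF ab(2)] e h_eq by (simp add: EM_arr_iff)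
  next
    fix k assume k: "(z, k) \<in> algebras X T" "e \<circ>\<^sub>X amap G (\<epsilon> b) = k \<circ>\<^sub>X amap G (amap F e)"
    show "k = h"
      by (rule surcoequalizer_cancel[OF X T_coeq])
        (use k h h_eq z algebra_over[OF k(1)] in \<open>auto simp: algebra_iff hom_def\<close>)
  next
    fix y k v assume yk: "(y, k) \<in> algebras X T" and v_hom: "v \<in> hom X z y"
      and ve: "((omap G b, amap G (\<epsilon> b)), v \<circ>\<^sub>X e, (y, k)) \<in> Arr (EM X T)"
    have v: "v \<in> Arr X" "Dom X v = z" "Cod X v = y" using v_hom by (auto simp: hom_def)
    have k: "y \<in> Obj X" "k \<in> Arr X" "Dom X k = omap G (omap F y)" "Cod X k = y"
      "amap (arity X) k = Ident S (omap (arity X) y)"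
      using yk algebra_over[OF yk] by (simp_all add: algebra_iff)
    have "v \<circ>\<^sub>X h = k \<circ>\<^sub>X amap G (amap F v)"
    proof (rule surcoequalizer_cancel[OF X T_coeq])
      have "(v \<circ>\<^sub>X h) \<circ>\<^sub>X amap G (amap F e) = v \<circ>\<^sub>X (h \<circ>\<^sub>X amap G (amap F e))"
        using v h e z by simp
      also have "\<dots> = (v \<circ>\<^sub>X e) \<circ>\<^sub>X amap G (\<epsilon> b)"
        unfolding h_eq using v e ab by simp
      also have "\<dots> = k \<circ>\<^sub>X amap G (amap F (v \<circ>\<^sub>X e))"
        using ve unfolding EM_arr_iff by blast
      also have "\<dots> = (k \<circ>\<^sub>X amap G (amap F v)) \<circ>\<^sub>X amap G (amap F e)"
        using v e k z by simp
      finally show "(v \<circ>\<^sub>X h) \<circ>\<^sub>X amap G (amap F e) =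
          (k \<circ>\<^sub>X amap G (amap F v)) \<circ>\<^sub>X amap G (amap F e)" .
    qed (use v h k z in \<open>simp_all add: hom_def\<close>)
    then show "((z, h), v, (y, k)) \<in> Arr (EM X T)"
      using alg yk v by (simp add: EM_arr_iff)
  qed
qed

text \<open>Bijectivity of \<open>K\<close> makes \<open>G\<close> faithful and full onto homomorphisms, so the lift, its uniqueness
  and the universal property are all read off in the category of algebras. A competing lift
  \<open>q'\<close> ends at an object whose algebra structure makes \<open>e\<close> a homomorphism, and
  there is only one such structure on \<open>z\<close>.\<close>

lemma iso_imp_absolute_creation:
  assumes iso: "sur_isomorphism S A (EM X T) K"
  shows "creates_surcoequalizers S A G (absolute_surcoequalizer S X)"
  unfolding creates_surcoequalizers_def
proof (intro allI impI, elim conjE)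
  have obj_inj: "inj_on (omap K) (Obj A)" and arr_inj: "inj_on (amap K) (Arr A)"
    and arr_surj: "\<And>w. w \<in> Arr (EM X T) \<Longrightarrow> \<exists>u \<in> Arr A. w = amap K u"
    using iso by (auto simp: K_iso_iff bij_betw_def)
  have faithful: "k = l" if "k \<in> hom A a b" "l \<in> hom A a b" "amap G k = amap G l" for k l a b
    using that inj_onD[OF arr_inj, of k l] by (auto simp: K_arr hom_def)
  have full: "\<exists>k \<in> hom A a b. amap G k = u"
    if "a \<in> Obj A" "b \<in> Obj A" and u: "(omap K a, u, omap K b) \<in> Arr (EM X T)" for a b u
  proof -
    obtain k where k: "k \<in> Arr A" "(omap K a, u, omap K b) = amap K k"
      using arr_surj[OF u] by blast
    then have "Dom A k = a" "Cod A k = b" "amap G k = u"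
      using that inj_on_eq_iff[OF obj_inj] by (auto simp: K_arr_shape)
    then show ?thesis using k by (auto simp: hom_def)
  qed
  fix B a b f g z e
  assume pair: "parallel_pair S A B a b f g"
    and abs: "absolute_surcoequalizer S X B (omap G a) (omap G b) (amap G f) (amap G g) z e"
  obtain h where e_arr: "((omap G b, amap G (\<epsilon> b)), e, (z, h)) \<in> Arr (EM X T)"
    and h_unique: "\<And>k. (z, k) \<in> algebras X T \<Longrightarrow>
      e \<circ>\<^sub>X amap G (\<epsilon> b) = k \<circ>\<^sub>X amap G (amap F e) \<Longrightarrow> k = h"
    and descend: "\<And>y k v. \<lbrakk>(y, k) \<in> algebras X T; v \<in> hom X z y;
      ((omap G b, amap G (\<epsilon> b)), v \<circ>\<^sub>X e, (y, k)) \<in> Arr (EM X T)\<rbrakk> \<Longrightarrow>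
      ((z, h), v, (y, k)) \<in> Arr (EM X T)"
    using absolute_surcoequalizer_algebra[OF pair abs] by blast
  have fg: "f \<in> Arr A" "Dom A f = a" "Cod A f = b" "g \<in> Arr A" "Dom A g = a" "Cod A g = b"
    using pair by (auto simp: parallel_pair_def hom_def fiber_def)
  have b: "b \<in> Obj A" using A.cod_closed[OF fg(1)] fg by simp
  have e_fork: "e \<circ>\<^sub>X amap G f = e \<circ>\<^sub>X amap G g" and e_over: "amap (arity X) e = Ident S B"
    and e_univ: "\<And>y q'. \<lbrakk>q' \<in> hom X (omap G b) y; q' \<circ>\<^sub>X amap G f = q' \<circ>\<^sub>X amap G g\<rbrakk> \<Longrightarrow>
      \<exists>!k. k \<in> hom X z y \<and> amap (arity X) k = amap (arity X) q' \<and> k \<circ>\<^sub>X e = q'"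
    using abs unfolding absolute_surcoequalizer_def surcoequalizer_def
    by (blast, simp add: hom_def fiber_def, blast)
  obtain q where q: "q \<in> Arr A" "amap K q = ((omap G b, amap G (\<epsilon> b)), e, (z, h))"
    using arr_surj[OF e_arr] by metis
  define c where "c = Cod A q"
  have c: "c \<in> Obj A" "omap K c = (z, h)" "omap G c = z" "amap G (\<epsilon> c) = h"
    using q A.cod_closed[OF q(1)] by (auto simp: c_def K_arr K_obj)
  have "Dom A q = b"
    using q b A.dom_closed[OF q(1)] inj_onD[OF obj_inj, of "Dom A q" b] by (simp add: K_arr K_obj)
  then have q_arr: "Dom A q = b" "Cod A q = c" "amap G q = e"
    using q by (simp_all add: c_def K_arr)
  have q_hom: "q \<in> hom A b c"
    using q q_arr by (simp add: hom_def)
  have unique: "c' = c \<and> q' = q"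
    if q': "q' \<in> hom A b c'" "omap G c' = z" "amap G q' = e" for c' q'
  proof -
    have q'_arr: "q' \<in> Arr A" "Dom A q' = b" "Cod A q' = c'" and c': "c' \<in> Obj A"
      using q'(1) A.cod_closed by (auto simp: hom_def)
    have "amap G (\<epsilon> c') = h"
      using h_unique[of "amap G (\<epsilon> c')"] counit_algebra[OF c'] G_counit_natural[OF q'_arr(1)]
        q'_arr q' by simp
    then have "c' = c"
      using c c' q'(2) inj_onD[OF obj_inj, of c' c] by (simp add: K_obj)
    then show ?thesis
      using faithful[of q' b c q] q' q q_arr by (simp add: hom_def)
  qed
  have "surcoequalizer S A B a b f g c q"
    unfolding surcoequalizer_def
  proof (intro conjI allI ballI impI pair)
    show "q \<in> hom (fiber S A B) b c"
      using q q_arr e_over G_simps(8)[OF q(1)] by (simp add: hom_def fiber_def)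
    show "q \<circ>\<^sub>A f = q \<circ>\<^sub>A g"
      using q q_arr fg e_fork by (intro faithful[of _ a c]) (simp_all add: hom_def)
  next
    fix y q' assume q': "q' \<in> hom A b y" and fork: "q' \<circ>\<^sub>A f = q' \<circ>\<^sub>A g"
    have q'_arr: "q' \<in> Arr A" "Dom A q' = b" "Cod A q' = y" and y: "y \<in> Obj A"
      using q' A.cod_closed by (auto simp: hom_def)
    have "amap G q' \<circ>\<^sub>X amap G f = amap G q' \<circ>\<^sub>X amap G g"
      using arg_cong[OF fork, of "amap G"] q'_arr fg by simp
    moreover have "amap G q' \<in> hom X (omap G b) (omap G y)"
      using q'_arr by (simp add: hom_def)
    ultimately obtain v where v: "v \<in> hom X z (omap G y)" "amap (arity X) v = amap (arity X) (amap G q')"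
        "v \<circ>\<^sub>X e = amap G q'"
      and v_unique: "\<And>v'. \<lbrakk>v' \<in> hom X z (omap G y); amap (arity X) v' = amap (arity X) (amap G q');
        v' \<circ>\<^sub>X e = amap G q'\<rbrakk> \<Longrightarrow> v' = v"
      using e_univ[of "amap G q'" "omap G y"] by blast
    have "((z, h), v, (omap G y, amap G (\<epsilon> y))) \<in> Arr (EM X T)"
      using descend[OF counit_algebra[OF y] v(1)] v(3) K_simps(2)[OF q'_arr(1)] K_arr[OF q'_arr(1)] q'_arr
      by simp
    then obtain k where k: "k \<in> hom A c y" "amap G k = v"
      using full[OF c(1) y, of v] c(2) K_obj[OF y] by auto
    have k_arr: "k \<in> Arr A" "Dom A k = c" "Cod A k = y" using k(1) by (auto simp: hom_def)
    show "\<exists>!k. k \<in> hom A c y \<and> amap (arity A) k = amap (arity A) q' \<and> k \<circ>\<^sub>A q = q'"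
    proof (intro ex1I[of _ k] conjI)
      show "k \<in> hom A c y" by (rule k)
      show "amap (arity A) k = amap (arity A) q'"
        using v(2) k(2) k_arr q'_arr G_simps(8)[of k] by simp
      show "k \<circ>\<^sub>A q = q'"
        using k k_arr q q_arr q' q'_arr v(3) by (intro faithful[of _ b y]) (simp_all add: hom_def)
    next
      fix l assume l: "l \<in> hom A c y \<and> amap (arity A) l = amap (arity A) q' \<and> l \<circ>\<^sub>A q = q'"
      then have l_arr: "l \<in> Arr A" "Dom A l = c" "Cod A l = y" by (auto simp: hom_def)
      have "amap G l = v"
      proof (rule v_unique)
        show "amap G l \<in> hom X z (omap G y)" using l_arr c by (simp add: hom_def)
        show "amap (arity X) (amap G l) = amap (arity X) (amap G q')" using l l_arr q'_arr by simp
        show "amap G l \<circ>\<^sub>X e = amap G q'" using l l_arr q q_arr by (metis G_simps(6))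
      qed
      then show "l = k" using faithful[of l c y k] l k by simp
    qed
  qed
  then show "\<exists>c q. q \<in> hom A b c \<and> omap G c = z \<and> amap G q = e \<and>
      (\<forall>c' q'. q' \<in> hom A b c' \<and> omap G c' = z \<and> amap G q' = e \<longrightarrow> c' = c \<and> q' = q) \<and>
      surcoequalizer S A B a b f g c q"
    using q_hom q_arr(3) c(3) unique by blast
qed

end

theorem theorem4:
  fixes \<G> :: "('b, 'h) cat"
    and \<A> :: "('o, 'a, 'b, 'h) surcat" and \<X> :: "('p, 'c, 'b, 'h) surcat"
    and F :: "('p, 'c, 'o, 'a) func" and G :: "('o, 'a, 'p, 'c) func"
    and \<eta> :: "'p \<Rightarrow> 'c" and \<epsilon> :: "'o \<Rightarrow> 'a"
    and T :: "('p, 'c) monad"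
    and K :: "('o, 'a, 'p \<times> 'c, ('p \<times> 'c) \<times> 'c \<times> ('p \<times> 'c)) func"
  assumes "category \<G>" and "surcategory \<G> \<A>" and "surcategory \<G> \<X>"
    and "suradjunction \<G> \<A> \<X> F G \<eta> \<epsilon>"
    and "T = induced_monad F G \<eta> \<epsilon>"
    and "comparison \<G> \<A> \<X> F G T K"
  shows "(sur_isomorphism \<G> \<A> (EM \<X> T) K \<longleftrightarrow>
            creates_surcoequalizers \<G> \<A> G (absolute_surcoequalizer \<G> \<X>)) \<and>
         (creates_surcoequalizers \<G> \<A> G (absolute_surcoequalizer \<G> \<X>) \<longleftrightarrow>
            creates_surcoequalizers \<G> \<A> G (split_surcoequalizer \<G> \<X>))"
proof -
  interpret comparison_situation \<G> \<A> \<X> F G \<eta> \<epsilon> K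
    using assms(2-6) by unfold_locales auto
  have "creates_surcoequalizers \<G> \<A> G (split_surcoequalizer \<G> \<X>)"
    if "creates_surcoequalizers \<G> \<A> G (absolute_surcoequalizer \<G> \<X>)"
    using that split_absolute[OF assms(3)] by (rule creates_mono)
  then show ?thesis
    using split_creation_imp_iso iso_imp_absolute_creation assms(5) by blast
qed

end
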